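(* Let $k=p_1^{a_1}\cdots p_m^{a_m}$ be the prime factorization of $k$, where $p_1,\ldots,p_m$ are distinct primes. Suppose that for every positive integer $n$ with $\gcd(k,n)=1$ we have $G_n^{(k)}=G_n^{(1)}$, where $G_n^{(j)}=\sum_{x\in \mathbb{F}_{2^n}^*}(-1)^{Tr_n(x^{2^j+1}+x^{-1})}$ and $Tr_n$ denotes the trace from $\mathbb{F}_{2^n}$ to $\mathbb{F}_2$. Then \[ L_{D_k}(t)=\frac{q_{m,1}(t^{p_m})}{q_{m,2}(t^{p_m})}\frac{q_{m-1,1}(t^{p_{m-1}})}{q_{m-1,2}(t^{p_{m-1}})}\cdots\frac{q_{2,1}(t^{p_{2}})}{q_{2,2}(t^{p_{2}})} q_1 (t^{p_1})L_{D_1}(t) \] for some polynomials $q_{i,1}(t),q_{i,2}(t)$ and $q_1(t)$ in $\mathbb{Z}[t]$. Conversely, if \[ L_{D_k}(t)=\frac{q_{m,1}(t^{p_m})}{q_{m,2}(t^{p_m})}\cdots\frac{q_{2,1}(t^{p_{2}})}{q_{2,2}(t^{p_{2}})} q_1 (t^{p_1})L_{D_1}(t) \] for some polynomials $q_{i,1}(t),q_{i,2}(t),q_1(t)\in\mathbb{Z}[t]$, then $G_n^{(k)}=G_n^{(1)}$ for every positive integer $n$ with $\gcd(k,n)=1$.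
   Context: For $k\geq 1$, $D_k$ denotes the hyperelliptic curve over $\mathbb{F}_2$ defined by the affine equation $y^2+y=x^{2^k+1}+x^{-1}$, and $L_{D_k}(t)\in\mathbb{Z}[t]$ denotes its L-polynomial over $\mathbb{F}_2$ (the numerator of its zeta function $Z(t)=L(t)/((1-t)(1-2t))$). One has $\#D_k(\mathbb{F}_{2^n})=2^n+1-G_n^{(k)}$. *)

theory Defs
  imports
    "HOL-Algebra.Algebraic_Closure_Type"
    "HOL-Library.Z2"
    "HOL-Computational_Algebra.Computational_Algebra"
begin

type_synonym F2bar = "bit alg_closure"

text \<open>
  The field with \<open>2^n\<close> elements (\<open>n > 0\<close>) is realised inside one fixed algebraic closure of the
  prime field, as the splitting field of \<open>X^(2^n) - X\<close>.
\<close>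

definition GF2 :: "nat \<Rightarrow> F2bar set" where
  "GF2 n = {x. x ^ (2 ^ n) = x}"

text \<open>
  The sum of the Galois conjugates lies in the prime field whenever \<open>x \<in> GF2 n\<close>
  (lemma \<open>to_ac_Tr\<close> below), so \<open>of_ac\<close> only reads it as an element of \<open>bit\<close>.
\<close>

definition Tr :: "nat \<Rightarrow> F2bar \<Rightarrow> bit" where
  "Tr n x = of_ac (\<Sum>i<n. x ^ (2 ^ i))"

lemma CHAR_bit [simp]: "CHAR(bit) = 2"
proof (rule CHAR_eqI)
  show "of_nat 2 = (0 :: bit)" by (simp add: numeral_2_eq_2)
  show "2 dvd n" if "of_nat n = (0 :: bit)" for n
    using that by (metis even_of_nat even_zero)
qed

lemma CHAR_F2bar: "CHAR(F2bar) = 2"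
  by simp

lemma two_F2bar: "(2 :: F2bar) = 0"
  by (metis CHAR_F2bar of_nat_CHAR of_nat_numeral)

lemma GF2_0: "0 \<in> GF2 n" and GF2_1: "1 \<in> GF2 n"
  by (simp_all add: GF2_def)

lemma GF2_add:
  assumes "x \<in> GF2 n" "y \<in> GF2 n"
  shows "x + y \<in> GF2 n"
  using assms freshmans_dream'[where ?'a = F2bar, of "2 ^ n" n x y] by (simp add: GF2_def)

lemma GF2_mult: "x \<in> GF2 n \<Longrightarrow> y \<in> GF2 n \<Longrightarrow> x * y \<in> GF2 n"
  by (simp add: GF2_def power_mult_distrib)

lemma GF2_inverse: "x \<in> GF2 n \<Longrightarrow> inverse x \<in> GF2 n"
  by (simp add: GF2_def power_inverse)

lemma GF2_power: "x \<in> GF2 n \<Longrightarrow> x ^ e \<in> GF2 n"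
  by (induction e) (auto intro: GF2_mult GF2_1)

lemma card_GF2:
  assumes "n > 0"
  shows "card (GF2 n) = 2 ^ n"
proof -
  define P :: "F2bar poly" where "P = Polynomial.monom 1 (2 ^ n) + Polynomial.monom (- 1) 1"
  have n2: "(2::nat) ^ n > 1" using assms by (intro one_less_power) auto
  have deg: "Polynomial.degree P = 2 ^ n"
    unfolding P_def using n2 by (subst degree_add_eq_left) (auto simp: Polynomial.degree_monom_eq)
  have P0: "P \<noteq> 0" using deg n2 by auto
  have roots: "{x. poly P x = 0} = GF2 n"
    by (auto simp: P_def GF2_def poly_monom)
  have pd: "pderiv P = [:- 1:]"
    using assms by (auto simp: P_def pderiv_add pderiv_monom two_F2bar monom_0)
  obtain A where A: "size A = Polynomial.degree P"
      "P = smult (Polynomial.lead_coeff P) (\<Prod>x\<in>#A. [:- x, 1:])"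
    using alg_closed_imp_factorization[OF P0] by blast
  have P_eq: "P = (\<Prod>x\<in>#A. [:- x, 1:])"
  proof -
    have "Polynomial.lead_coeff P = 1"
      unfolding deg using n2 by (simp add: P_def)
    thus ?thesis using A(2) by simp
  qed
  have distinct: "count A x \<le> 1" for x
  proof (rule ccontr)
    assume "\<not> count A x \<le> 1"
    hence "x \<in># A" by (simp add: not_le count_greater_zero_iff[symmetric] del: count_greater_zero_iff)
    then obtain A' where A': "A = add_mset x A'" by (blast dest: multi_member_split)
    with \<open>\<not> count A x \<le> 1\<close> have "x \<in># A'"
      by (simp add: not_le)
    then obtain B where "A' = add_mset x B" by (blast dest: multi_member_split)
    with A' have "A = add_mset x (add_mset x B)" by simp
    hence "P = [:- x, 1:] * ([:- x, 1:] * (\<Prod>x\<in>#B. [:- x, 1:]))"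
      using P_eq by simp
    hence "poly (pderiv P) x = 0"
      by (simp only: pderiv_mult poly_add poly_mult) simp
    thus False by (simp add: pd)
  qed
  have set: "set_mset A = GF2 n"
  proof -
    have "poly P x = 0 \<longleftrightarrow> x \<in># A" for x
      by (subst P_eq, induction A) auto
    thus ?thesis using roots by auto
  qed
  have "A = mset_set (set_mset A)"
    using distinct by (intro multiset_eqI) (metis count_mset_set(1,3) count_greater_zero_iff
      finite_set_mset le_antisym less_one not_less not_in_iff)
  hence "size A = card (set_mset A)" by (metis size_mset_set)
  thus ?thesis using A(1) deg set by simp
qed

lemma to_ac_Tr:
  assumes "x \<in> GF2 n"
  shows "to_ac (Tr n x) = (\<Sum>i<n. x ^ (2 ^ i))"
proof -
  define s where "s = (\<Sum>i<n. x ^ (2 ^ i))"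
  have "s ^ 2 = (\<Sum>i<n. (x ^ (2 ^ i)) ^ 2)"
    unfolding s_def by (rule freshmans_dream_sum) (auto simp: CHAR_F2bar)
  also have "\<dots> = (\<Sum>i<n. x ^ (2 ^ Suc i))"
    by (simp flip: power_mult add: mult.commute)
  also have "\<dots> + x = (\<Sum>i<Suc n. x ^ (2 ^ i))"
    by (subst sum.lessThan_Suc_shift) simp
  also have "\<dots> = s + x"
    using assms by (simp add: s_def GF2_def)
  finally have "s * (s - 1) = 0" by (simp add: power2_eq_square algebra_simps)
  hence "s = to_ac 0 \<or> s = to_ac 1" by auto
  hence "s \<in> range to_ac" by blast
  thus ?thesis by (simp add: Tr_def to_ac_of_ac flip: s_def)
qed

definition sign_char :: "bit \<Rightarrow> int" where
  "sign_char b = (if b = 0 then 1 else - 1)"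

definition G :: "nat \<Rightarrow> nat \<Rightarrow> int" where
  "G n j = (\<Sum>x \<in> GF2 n - {0}. sign_char (Tr n (x ^ (2 ^ j + 1) + inverse x)))"

text \<open>
  The smooth projective model of \<open>y^2 + y = x^(2^k+1) + x^(-1)\<close>.  Replacing \<open>y\<close> by \<open>y / x\<close> turns the
  equation into \<open>y^2 + x y = x^(2g+1) + x\<close> with \<open>g = 2^(k-1) + 1\<close>, whose weighted homogenisation in
  the weighted projective plane \<open>P(1, g+1, 1)\<close> is used below.  The chart \<open>z = 1\<close> is the affine
  curve just given; the chart \<open>x = 1\<close> is \<open>v^2 + u^g v = u + u^(2g+1)\<close>.  Both charts are smooth
  (the \<open>y\<close>-derivative \<open>x\<close> vanishes only at \<open>(0,0)\<close>, where the \<open>x\<close>-derivative is \<open>1\<close>; likewise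
  for \<open>u, v\<close>), and \<open>g\<close> is the genus.
\<close>

definition D_genus :: "nat \<Rightarrow> nat" where
  "D_genus k = 2 ^ (k - 1) + 1"

definition D_triples :: "nat \<Rightarrow> nat \<Rightarrow> (F2bar \<times> F2bar \<times> F2bar) set" where
  "D_triples k n = {(x, y, z). x \<in> GF2 n \<and> y \<in> GF2 n \<and> z \<in> GF2 n \<and> (x, z) \<noteq> (0, 0) \<and>
     y ^ 2 + x * z ^ D_genus k * y = x ^ (2 * D_genus k + 1) * z + x * z ^ (2 * D_genus k + 1)}"

definition D_scaling ::
  "nat \<Rightarrow> nat \<Rightarrow> ((F2bar \<times> F2bar \<times> F2bar) \<times> (F2bar \<times> F2bar \<times> F2bar)) set" where
  "D_scaling k n = {((x, y, z), (x', y', z')).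
     (x, y, z) \<in> D_triples k n \<and> (x', y', z') \<in> D_triples k n \<and>
     (\<exists>c \<in> GF2 n - {0}. x' = c * x \<and> y' = c ^ (D_genus k + 1) * y \<and> z' = c * z)}"

definition D_points :: "nat \<Rightarrow> nat \<Rightarrow> (F2bar \<times> F2bar \<times> F2bar) set set" where
  "D_points k n = D_triples k n // D_scaling k n"

text \<open>
  Hence the rational points are those of the given affine equation together with the two rational
  points over \<open>x = 0\<close> and \<open>x = \<infinity>\<close>.
\<close>

lemma D_triples_scale:
  assumes "(x, y, z) \<in> D_triples k n" "c \<in> GF2 n - {0}"
  shows "(c * x, c ^ (D_genus k + 1) * y, c * z) \<in> D_triples k n"
proof -
  define g where "g = D_genus k"
  have eq: "y ^ 2 + x * z ^ g * y = x ^ (2 * g + 1) * z + x * z ^ (2 * g + 1)"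
    using assms by (simp add: D_triples_def g_def)
  have "(c ^ (g + 1) * y) ^ 2 + (c * x) * (c * z) ^ g * (c ^ (g + 1) * y) =
      c ^ (2 * g + 2) * (y ^ 2 + x * z ^ g * y)"
    by (simp add: power_mult_distrib power_add power_mult algebra_simps power2_eq_square)
  also have "\<dots> = (c * x) ^ (2 * g + 1) * (c * z) + (c * x) * (c * z) ^ (2 * g + 1)"
    by (subst eq) (simp add: power_mult_distrib power_add power_mult algebra_simps power2_eq_square)
  finally show ?thesis
    using assms by (auto simp: D_triples_def g_def[symmetric] intro!: GF2_mult GF2_power)
qed

lemma equiv_D_scaling: "equiv (D_triples k n) (D_scaling k n)"
proof (rule equivI)
  show "D_scaling k n \<subseteq> D_triples k n \<times> D_triples k n"
    by (auto simp: D_scaling_def)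
  show "refl_on (D_triples k n) (D_scaling k n)"
    by (auto simp: refl_on_def D_scaling_def GF2_1 intro!: bexI[of _ 1])
  show "sym (D_scaling k n)"
  proof (rule symI, clarify)
    fix x y z x' y' z' assume "((x, y, z), (x', y', z')) \<in> D_scaling k n"
    then obtain c where c: "(x, y, z) \<in> D_triples k n" "(x', y', z') \<in> D_triples k n"
        "c \<in> GF2 n" "c \<noteq> 0" "x' = c * x" "y' = c ^ (D_genus k + 1) * y" "z' = c * z"
      unfolding D_scaling_def by auto
    have "inverse c \<in> GF2 n - {0}"
      using c GF2_inverse by simp
    moreover have "x = inverse c * x'"
        "y = inverse c ^ (D_genus k + 1) * y'" "z = inverse c * z'"
      using c by (simp_all add: power_inverse flip: mult.assoc del: power_Suc)
    ultimately show "((x', y', z'), (x, y, z)) \<in> D_scaling k n"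
      using c(1,2) unfolding D_scaling_def by blast
  qed
  show "trans (D_scaling k n)"
  proof (rule transI, clarify)
    fix x y z x' y' z' x'' y'' z''
    assume "((x, y, z), (x', y', z')) \<in> D_scaling k n"
      and "((x', y', z'), (x'', y'', z'')) \<in> D_scaling k n"
    then obtain c d where cd: "(x, y, z) \<in> D_triples k n" "(x'', y'', z'') \<in> D_triples k n"
        "c \<in> GF2 n" "c \<noteq> 0" "x' = c * x" "y' = c ^ (D_genus k + 1) * y" "z' = c * z"
        "d \<in> GF2 n" "d \<noteq> 0" "x'' = d * x'" "y'' = d ^ (D_genus k + 1) * y'" "z'' = d * z'"
      unfolding D_scaling_def by auto
    have "d * c \<in> GF2 n - {0}" "x'' = (d * c) * x"
        "y'' = (d * c) ^ (D_genus k + 1) * y" "z'' = (d * c) * z"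
      using cd by (auto simp: GF2_mult power_mult_distrib)
    thus "((x, y, z), (x'', y'', z'')) \<in> D_scaling k n"
      using cd(1,2) unfolding D_scaling_def by blast
  qed
qed

lemma card_D_points:
  assumes "k > 0" "n > 0"
  shows "card (D_points k n) = card {(x, y). x \<in> GF2 n - {0} \<and> y \<in> GF2 n \<and>
     y ^ 2 + y = x ^ (2 ^ k + 1) + inverse x} + 2"
proof -
  define g where "g = D_genus k"
  have g: "g > 0" by (simp add: g_def D_genus_def)
  have g2: "2 * g + 1 = (2 ^ k + 1) + 2"
    using assms(1) by (cases k) (auto simp: g_def D_genus_def)
  define T where "T = {(x, y). x \<in> GF2 n - {0} \<and> y \<in> GF2 n \<and>
     y ^ 2 + y = x ^ (2 ^ k + 1) + inverse x}"
  define h :: "F2bar \<times> F2bar \<Rightarrow> F2bar \<times> F2bar \<times> F2bar" where "h = (\<lambda>(x, y). (x, x * y, 1))"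
  define R where "R = insert (1, 0, 0) (insert (0, 0, 1) (h ` T))"
  have eq: "(x * y) ^ 2 + x * (x * y) = x ^ (2 * g + 1) + x \<longleftrightarrow>
      y ^ 2 + y = x ^ (2 ^ k + 1) + inverse x" if "x \<noteq> 0" for x y :: F2bar
  proof -
    have "(x * y) ^ 2 + x * (x * y) = x ^ 2 * (y ^ 2 + y)"
      by (simp add: algebra_simps power2_eq_square)
    moreover have "x ^ (2 * g + 1) + x = x ^ 2 * (x ^ (2 ^ k + 1) + inverse x)"
      unfolding g2 power_add using that by (simp add: algebra_simps power2_eq_square)
    ultimately show ?thesis using that by simp
  qed
  have finGF: "finite (GF2 n)"
    using card_GF2[OF assms(2)] by (intro card_ge_0_finite) simp
  have finT: "finite T"
    by (rule finite_subset[of _ "GF2 n \<times> GF2 n"]) (auto simp: T_def finGF)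
  have R_sub: "R \<subseteq> D_triples k n"
  proof -
    have "h t \<in> D_triples k n" if "t \<in> T" for t
      using that eq unfolding T_def h_def D_triples_def g_def[symmetric]
      by (auto intro: GF2_mult GF2_1 simp del: power_Suc)
    moreover have "(1, 0, 0) \<in> D_triples k n" "(0, 0, 1) \<in> D_triples k n"
      using g by (auto simp: D_triples_def GF2_0 GF2_1 g_def[symmetric])
    ultimately show ?thesis by (auto simp: R_def)
  qed
  have bij: "bij_betw (\<lambda>r. D_scaling k n `` {r}) R (D_points k n)"
  proof (rule bij_betwI')
    fix r s assume rs: "r \<in> R" "s \<in> R"
    show "(D_scaling k n `` {r} = D_scaling k n `` {s}) = (r = s)"
    proof
      assume "D_scaling k n `` {r} = D_scaling k n `` {s}"
      hence "(r, s) \<in> D_scaling k n"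
        using rs R_sub eq_equiv_class_iff[OF equiv_D_scaling] by blast
      thus "r = s"
        using rs by (auto simp: D_scaling_def R_def h_def T_def)
    qed simp
  next
    fix r assume "r \<in> R"
    thus "D_scaling k n `` {r} \<in> D_points k n"
      using R_sub by (auto simp: D_points_def intro: quotientI)
  next
    fix C assume "C \<in> D_points k n"
    then obtain x y z where C: "(x, y, z) \<in> D_triples k n" "C = D_scaling k n `` {(x, y, z)}"
      by (auto simp: D_points_def elim!: quotientE)
    have *: "\<exists>r\<in>R. C = D_scaling k n `` {r}"
      if c: "c \<in> GF2 n - {0}" and R: "(c * x, c ^ (g + 1) * y, c * z) \<in> R" for c
    proof -
      have "((x, y, z), (c * x, c ^ (g + 1) * y, c * z)) \<in> D_scaling k n"
        using C(1) c D_triples_scale[OF C(1) c] by (auto simp: D_scaling_def g_def)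
      thus ?thesis
        using R C(2) equiv_class_eq[OF equiv_D_scaling] by blast
    qed
    show "\<exists>r\<in>R. C = D_scaling k n `` {r}"
    proof (cases "z = 0")
      case True
      hence "x \<noteq> 0" "x \<in> GF2 n" "y = 0"
        using C(1) g by (auto simp: D_triples_def g_def[symmetric] zero_power)
      thus ?thesis
        using True by (intro *[of "inverse x"]) (auto simp: R_def GF2_inverse)
    next
      case False
      define c where "c = inverse z"
      have c: "c \<in> GF2 n - {0}"
        using C(1) False by (auto simp: D_triples_def c_def GF2_inverse)
      define u v where "u = c * x" and "v = c ^ (g + 1) * y"
      have uv: "(u, v, 1) \<in> D_triples k n"
        using D_triples_scale[OF C(1) c] False by (simp add: u_def v_def g_def c_def)
      hence uv': "u \<in> GF2 n" "v \<in> GF2 n" "v ^ 2 + u * v = u ^ (2 * g + 1) + u"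
        by (auto simp: D_triples_def g_def)
      have "(u, v, 1) \<in> R"
      proof (cases "u = 0")
        case True
        thus ?thesis using uv'(3) by (auto simp: R_def)
      next
        case False
        have "(u, inverse u * v) \<in> T"
          using uv' False eq[of u "inverse u * v"]
          by (auto simp: T_def GF2_mult GF2_inverse simp flip: mult.assoc simp del: power_Suc)
        moreover have "h (u, inverse u * v) = (u, v, 1)"
          using False by (simp add: h_def flip: mult.assoc)
        ultimately show ?thesis unfolding R_def by (metis image_eqI insertCI)
      qed
      thus ?thesis
        using False c by (intro *[of c]) (auto simp: u_def v_def c_def)
    qed
  qed
  have "inj_on h T" by (auto simp: inj_on_def h_def T_def)
  hence "card (h ` T) = card T" by (rule card_image)
  moreover have "(0, 0, 1) \<notin> h ` T" "(1, 0, 0) \<notin> insert (0, 0, 1) (h ` T)"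
    by (auto simp: h_def T_def)
  ultimately have "card R = card T + 2"
    using finT by (simp add: R_def)
  thus ?thesis
    using bij_betw_same_card[OF bij] by (simp add: T_def)
qed

definition zeta_D :: "nat \<Rightarrow> rat fps" where
  "zeta_D k = fps_exp 1 oo
     Abs_fps (\<lambda>n. if n = 0 then 0 else of_nat (card (D_points k n)) / of_nat n)"

text \<open>
  The numerator of the zeta function.  Uniqueness is clear because the fraction determines its
  numerator; existence (rationality of the zeta function with integral numerator) is a theorem
  that is not built into the definition.
\<close>

definition L_D :: "nat \<Rightarrow> int poly" where
  "L_D k = (THE L. zeta_D k = fps_of_poly (map_poly of_int L) / ((1 - fps_X) * (1 - 2 * fps_X)))"

text \<open>\<open>q(t^e)\<close>:\<close>

definition subst_power :: "int poly \<Rightarrow> nat \<Rightarrow> int poly" where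
  "subst_power q e = pcompose q (Polynomial.monom 1 e)"

end

theory Submission
  imports Defs
begin

text \<open>
  Write \<open>L\<^sub>k\<close> for the power series \<open>exp (\<Sum> G\<^sub>n t^n / n)\<close>. Expanding it over monic polynomials over
  the prime field shows that it is a polynomial with integer coefficients: the character attached to
  the exponential sum has sum zero over the monic polynomials of each degree \<open>\<ge> 2^k + 3\<close>. So
  \<open>L\<^sub>k\<close> is the L-polynomial, and \<open>G\<^sub>n\<close> is read off from the logarithmic derivative \<open>t L\<^sub>k' / L\<^sub>k\<close>.
  The logarithmic derivative of a function of \<open>t^p\<close> has terms at multiples of \<open>p\<close> only; this gives
  the converse part.

  For the direct part let \<open>F = L\<^sub>k / L\<^sub>1\<close>. For a prime \<open>q\<close>, dividing \<open>F^q\<close> by the norm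
  \<open>\<Prod>\<^sub>\<zeta> F(\<zeta> t)\<close> over the \<open>q\<close>-th roots of unity, which is a rational function of \<open>t^q\<close>, kills the
  terms of the logarithmic derivative at multiples of \<open>q\<close> and multiplies the others by \<open>q\<close>. Doing this
  for all \<open>p\<^sub>j\<close> with \<open>j \<noteq> i\<close> leaves terms at multiples of \<open>p\<^sub>i\<close> only, that is, a rational
  function of \<open>t^p\<^sub>i\<close>. Hence the power of \<open>F\<close> with exponent \<open>\<Prod>\<^sub>j\<^sub>\<noteq>\<^sub>i p\<^sub>j\<close> is a product of rational
  functions of the \<open>t^p\<^sub>j\<close>; these exponents have no common factor, so \<open>F\<close> itself is one. For
  \<open>m \<ge> 2\<close> the denominator of the first factor can be moved into the second one; for \<open>m = 1\<close> it is
  constant because it divides \<open>L\<^sub>1 = 1 + t + 2 t^3 + 4 t^4\<close>.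
\<close>

section \<open>Logarithmic derivatives of power series\<close>

lemma coeff_pcompose_monom:
  fixes q :: "'a :: comm_ring_1 poly"
  assumes "e > 0"
  shows "coeff (pcompose q (Polynomial.monom 1 e)) n = (if e dvd n then coeff q (n div e) else 0)"
proof (induction q arbitrary: n rule: pCons_induct)
  case (pCons c q)
  show ?case
  proof (cases "n < e")
    case True
    thus ?thesis using assms
      by (cases n) (auto simp: pcompose_pCons coeff_monom_mult coeff_pCons dest: dvd_imp_le)
  next
    case False
    then obtain j where j: "n = e + j" by (metis le_Suc_ex not_less)
    show ?thesis using assms pCons.IH[of j]
      by (auto simp: pcompose_pCons coeff_monom_mult coeff_pCons j split: nat.splits)
  qed
qed simp

lemma pcompose_monom_monom:
  fixes q :: "'a :: comm_ring_1 poly"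
  assumes "d > 0" "e > 0"
  shows "pcompose (pcompose q (Polynomial.monom 1 d)) (Polynomial.monom 1 e) =
    pcompose q (Polynomial.monom 1 (d * e))"
proof (rule poly_eqI)
  fix n
  have "e dvd n \<and> d dvd n div e \<longleftrightarrow> d * e dvd n"
    using assms(2) by (auto simp: dvd_def mult.commute mult.left_commute)
  thus "coeff (pcompose (pcompose q (Polynomial.monom 1 d)) (Polynomial.monom 1 e)) n =
      coeff (pcompose q (Polynomial.monom 1 (d * e))) n"
    using assms by (auto simp: coeff_pcompose_monom div_mult2_eq mult.commute[of d e])
qed

lemma poly_in_monom:
  fixes f :: "'a :: comm_ring_1 poly"
  assumes "e > 0" and "\<And>n. \<not> e dvd n \<Longrightarrow> coeff f n = 0"
  obtains q where "f = pcompose q (Polynomial.monom 1 e)"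
proof -
  define q where "q = Abs_poly (\<lambda>i. coeff f (e * i))"
  have "coeff f (e * i) = 0" if "i > Polynomial.degree f" for i
  proof (rule coeff_eq_0)
    have "i \<le> e * i" using assms(1) by simp
    thus "e * i > Polynomial.degree f" using that by linarith
  qed
  hence "coeff q i = coeff f (e * i)" for i
    unfolding q_def by (subst coeff_Abs_poly) auto
  hence "f = pcompose q (Polynomial.monom 1 e)"
    using assms by (intro poly_eqI) (auto simp: coeff_pcompose_monom)
  thus thesis by (rule that)
qed

lemma fps_of_poly_pcompose_monom:
  fixes q :: "'a :: idom poly"
  assumes "e > 0"
  shows "fps_of_poly (pcompose q (Polynomial.monom 1 e)) = fps_of_poly q oo fps_X ^ e"
  using assms by (subst fps_of_poly_pcompose) (auto simp: fps_of_poly_monom')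

text \<open>A relation in place of the quotient of \<open>fps_X * fps_deriv f\<close> by
  \<open>f\<close>, so that series without constant term and coefficient rings without division are
  covered.\<close>

definition has_log_deriv :: "'a :: comm_ring_1 fps \<Rightarrow> 'a fps \<Rightarrow> bool" where
  "has_log_deriv f l \<longleftrightarrow> fps_X * fps_deriv f = f * l"

lemma has_log_deriv_1: "has_log_deriv 1 0"
  by (simp add: has_log_deriv_def)

lemma has_log_deriv_mult:
  assumes "has_log_deriv f l" "has_log_deriv g l'"
  shows "has_log_deriv (f * g) (l + l')"
proof -
  have "fps_X * fps_deriv (f * g) = f * (fps_X * fps_deriv g) + (fps_X * fps_deriv f) * g"
    by (simp add: algebra_simps)
  also have "\<dots> = f * g * (l + l')"
    using assms unfolding has_log_deriv_def by (simp only: algebra_simps)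
  finally show ?thesis by (simp add: has_log_deriv_def)
qed

lemma has_log_deriv_prod:
  "(\<And>i. i \<in> A \<Longrightarrow> has_log_deriv (f i) (l i)) \<Longrightarrow> has_log_deriv (\<Prod>i\<in>A. f i) (\<Sum>i\<in>A. l i)"
  by (induction A rule: infinite_finite_induct)
     (auto intro: has_log_deriv_1 has_log_deriv_mult)

lemma has_log_deriv_power:
  "has_log_deriv f l \<Longrightarrow> has_log_deriv (f ^ n) (of_nat n * l)"
  using has_log_deriv_prod[of "{..<n}" "\<lambda>_. f" "\<lambda>_. l"] by simp

lemma has_log_deriv_cancel:
  fixes f g :: "'a :: idom fps"
  assumes "has_log_deriv (f * g) (l + l')" "has_log_deriv f l" "f \<noteq> 0"
  shows "has_log_deriv g l'"
proof -
  have "f * (fps_X * fps_deriv g) + g * (fps_X * fps_deriv f) = f * g * (l + l')"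
    using assms(1) unfolding has_log_deriv_def fps_deriv_mult by (simp only: algebra_simps)
  hence "f * (fps_X * fps_deriv g) = f * (g * l')"
    using assms(2) unfolding has_log_deriv_def by (simp add: algebra_simps)
  thus ?thesis using assms(3) by (simp add: has_log_deriv_def)
qed

lemma has_log_deriv_unique:
  fixes f :: "'a :: idom fps"
  shows "has_log_deriv f l \<Longrightarrow> has_log_deriv f l' \<Longrightarrow> f \<noteq> 0 \<Longrightarrow> l = l'"
  by (metis has_log_deriv_def mult_left_cancel)

text \<open>Multiplying by \<open>fps_X\<close> restores the order that differentiation may lose, so
  \<open>f\<close> divides \<open>fps_X * fps_deriv f\<close> even when it is not a unit.\<close>

lemma has_log_deriv_ex:
  fixes f :: "'a :: field fps"
  assumes "f \<noteq> 0"
  shows "\<exists>l. has_log_deriv f l"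
proof -
  have "f dvd fps_X * fps_deriv f"
  proof (cases "fps_X * fps_deriv f = 0")
    case nz: False
    have "(fps_X * fps_deriv f) $ i = 0" if "i < subdegree f" for i
      unfolding fps_mult_fps_X_deriv_shift fps_nth_Abs_fps nth_less_subdegree_zero[OF that]
      by (rule mult_zero_right)
    with nz have "subdegree f \<le> subdegree (fps_X * fps_deriv f)"
      by (rule subdegree_geI)
    thus ?thesis unfolding fps_dvd_iff[OF assms nz] .
  next
    case True
    show ?thesis unfolding True by (rule dvd_0_right)
  qed
  then obtain l where "fps_X * fps_deriv f = f * l" by (rule dvdE)
  thus ?thesis unfolding has_log_deriv_def by blast
qed

lemma has_log_deriv_nth:
  assumes "has_log_deriv f l"
  shows "of_nat n * f $ n = (\<Sum>i=0..n. f $ i * l $ (n - i))"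
  using arg_cong[OF assms[unfolded has_log_deriv_def], of "\<lambda>f. f $ n"]
  by (simp add: fps_mult_fps_X_deriv_shift fps_mult_nth)

lemma has_log_derivI:
  assumes "\<And>n. of_nat n * f $ n = (\<Sum>i=0..n. f $ i * l $ (n - i))"
  shows "has_log_deriv f l"
  unfolding has_log_deriv_def fps_mult_fps_X_deriv_shift using assms
  by (auto simp: fps_eq_iff fps_mult_nth)

lemma has_log_deriv_0:
  fixes f :: "'a :: idom fps"
  shows "has_log_deriv f l \<Longrightarrow> f $ 0 \<noteq> 0 \<Longrightarrow> l $ 0 = 0"
  using has_log_deriv_nth[of f l 0] by auto

text \<open>The term at \<open>i = n\<close> drops out because \<open>l $ 0 = 0\<close>, which
  leaves a recursion for the coefficients of \<open>f\<close>.\<close>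

lemma has_log_deriv_rec:
  fixes f :: "'a :: idom fps"
  assumes "has_log_deriv f l" "f $ 0 \<noteq> 0"
  shows "of_nat n * f $ n = (\<Sum>i<n. f $ i * l $ (n - i))"
  using has_log_deriv_nth[OF assms(1), of n] has_log_deriv_0[OF assms]
  by (simp add: atLeast0AtMost lessThan_Suc_atMost[symmetric])

text \<open>In characteristic 0 the recursion determines every coefficient after the first. The zeta
  function is identified in this way.\<close>

lemma has_log_deriv_inject:
  fixes f g :: "'a :: {idom, ring_char_0} fps"
  assumes "has_log_deriv f l" "has_log_deriv g l" "f $ 0 = 1" "g $ 0 = 1"
  shows "f = g"
proof (rule fps_ext)
  fix n show "f $ n = g $ n"
  proof (induction n rule: less_induct)
    case (less n)
    have "of_nat n * f $ n = of_nat n * g $ n"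
      using less assms by (simp add: has_log_deriv_rec[OF assms(1)] has_log_deriv_rec[OF assms(2)])
    thus ?case using assms by (cases "n = 0") auto
  qed
qed

lemma has_log_deriv_compose_monom:
  fixes f :: "'a :: field fps"
  assumes "has_log_deriv f l" "e > 0"
  shows "has_log_deriv (f oo fps_X ^ e) (of_nat e * (l oo fps_X ^ e))"
proof -
  have X: "fps_X * fps_X ^ (e - 1) = (fps_X ^ e :: 'a fps)" using assms(2) by (cases e) auto
  have 0: "(fps_X ^ e :: 'a fps) $ 0 = 0" using assms(2) by simp
  have "fps_X * fps_deriv (f oo fps_X ^ e) =
      of_nat e * ((fps_X * fps_X ^ (e - 1)) * (fps_deriv f oo fps_X ^ e))"
    using assms(2) by (simp add: fps_compose_deriv fps_deriv_power' algebra_simps)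
  also have "\<dots> = of_nat e * ((fps_X * fps_deriv f) oo fps_X ^ e)"
    by (simp only: X fps_compose_mult_distrib[OF 0] fps_X_fps_compose_startby0[OF 0])
  also have "\<dots> = (f oo fps_X ^ e) * (of_nat e * (l oo fps_X ^ e))"
    using assms(1) by (simp add: has_log_deriv_def fps_compose_mult_distrib[OF 0])
  finally show ?thesis by (simp add: has_log_deriv_def)
qed

lemma has_log_deriv_compose_linear:
  fixes f :: "'a :: field fps"
  assumes "has_log_deriv f l"
  shows "has_log_deriv (f oo (fps_const c * fps_X)) (l oo (fps_const c * fps_X))"
proof -
  have 0: "(fps_const c * fps_X) $ 0 = 0" by simp
  have "fps_X * fps_deriv (f oo (fps_const c * fps_X)) =
     ((fps_X * fps_deriv f) oo (fps_const c * fps_X))"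
    by (simp add: fps_compose_deriv fps_compose_mult_distrib algebra_simps)
  thus ?thesis
    using assms unfolding has_log_deriv_def by (simp only: fps_compose_mult_distrib[OF 0])
qed

lemma fps_compose_X_power_nth:
  fixes f :: "'a :: comm_ring_1 fps"
  assumes "e > 0"
  shows "(f oo fps_X ^ e) $ n = (if e dvd n then f $ (n div e) else 0)"
proof -
  have "(f oo fps_X ^ e) $ n = (\<Sum>i=0..n. if n = e * i then f $ i else 0)"
    unfolding fps_compose_nth power_mult[symmetric] fps_X_power_nth by (intro sum.cong) auto
  also have "\<dots> = (\<Sum>i=0..n. if i = n div e \<and> e dvd n then f $ i else 0)"
    using assms by (intro sum.cong) auto
  finally show ?thesis by (auto simp: sum.delta)
qed

text \<open>If \<open>e\<close> does not divide \<open>n\<close>, it cannot divide both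
  \<open>i\<close> and \<open>n - i\<close>, so every term of the recursion for \<open>f $ n\<close>
  has a vanishing factor.\<close>

lemma has_log_deriv_supported:
  fixes f :: "'a :: {idom, ring_char_0} fps"
  assumes "has_log_deriv f l" "f $ 0 \<noteq> 0" "\<And>n. \<not> e dvd n \<Longrightarrow> l $ n = 0" "\<not> e dvd n"
  shows "f $ n = 0"
  using assms(4)
proof (induction n rule: less_induct)
  case (less n)
  have "f $ i * l $ (n - i) = 0" if "i < n" for i
  proof (cases "e dvd i")
    case True
    hence "\<not> e dvd n - i" using less.prems that by (meson dvd_diffD less_imp_le)
    thus ?thesis using assms(3) by simp
  qed (use that less.IH in simp)
  hence "of_nat n * f $ n = 0"
    unfolding has_log_deriv_rec[OF assms(1,2)] by (intro sum.neutral) auto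
  thus ?case using less.prems by (auto intro: ccontr)
qed

lemma has_log_deriv_inverse:
  fixes f :: "'a :: field fps"
  assumes "has_log_deriv f l" "f $ 0 \<noteq> 0"
  shows "has_log_deriv (inverse f) (- l)"
proof (rule has_log_deriv_cancel[OF _ assms(1)])
  have "f * inverse f = 1" using assms(2) by (metis inverse_mult_eq_1 mult.commute)
  thus "has_log_deriv (f * inverse f) (l + - l)" using has_log_deriv_1 by simp
  show "f \<noteq> 0" using assms(2) by auto
qed

text \<open>A geometric series: \<open>1 - c X\<close> times the sum of \<open>c^n X^n\<close> over
  \<open>n \<ge> 1\<close> is \<open>c X\<close>.\<close>

lemma has_log_deriv_linear:
  "has_log_deriv (1 - fps_const c * fps_X :: 'a :: field fps)
     (- Abs_fps (\<lambda>n. if n = 0 then 0 else c ^ n))"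
proof -
  define P where "P = Abs_fps (\<lambda>n. if n = 0 then 0 else c ^ n)"
  have "(1 - fps_const c * fps_X) * P = fps_const c * fps_X"
    unfolding left_diff_distrib mult_1_left mult.assoc
  proof (rule fps_ext)
    fix n show "(P - fps_const c * (fps_X * P)) $ n = (fps_const c * fps_X) $ n"
      by (cases n) (simp_all add: P_def)
  qed
  moreover have "fps_X * fps_deriv (1 - fps_const c * fps_X) = - (fps_const c * fps_X)"
    by (simp add: mult.commute)
  ultimately show ?thesis
    unfolding has_log_deriv_def P_def[symmetric] by (simp only: mult_minus_right)
qed

section \<open>Norms and products of rational functions\<close>

lemma of_rat_has_log_deriv:
  fixes f :: "rat fps"
  assumes "has_log_deriv f l"
  shows "has_log_deriv (Abs_fps (\<lambda>n. of_rat (f $ n) :: complex)) (Abs_fps (\<lambda>n. of_rat (l $ n)))"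
proof (rule has_log_derivI)
  fix n
  show "of_nat n * Abs_fps (\<lambda>n. of_rat (f $ n)) $ n =
      (\<Sum>i = 0..n. Abs_fps (\<lambda>n. of_rat (f $ n)) $ i * Abs_fps (\<lambda>n. of_rat (l $ n) :: complex) $ (n - i))"
    using arg_cong[OF has_log_deriv_nth[OF assms, of n], of "of_rat :: rat \<Rightarrow> complex"]
    by (simp add: of_rat_mult of_rat_sum)
qed

lemma has_log_deriv_Rats:
  fixes f :: "'a :: field_char_0 fps"
  assumes "has_log_deriv f l" "f $ 0 = 1" "\<And>n. l $ n \<in> \<rat>"
  shows "f $ n \<in> \<rat>"
proof (induction n rule: less_induct)
  case (less n)
  show ?case
  proof (cases "n = 0")
    case False
    have "of_nat n * f $ n \<in> \<rat>"
      using less assms(2,3) by (auto simp: has_log_deriv_rec[OF assms(1)] intro!: Rats_sum Rats_mult)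
    hence "of_nat n * f $ n / of_nat n \<in> \<rat>" by (intro Rats_divide) auto
    thus ?thesis using False by simp
  qed (use assms in auto)
qed

text \<open>Since \<open>f $ 0 = 1\<close>, the coefficients of \<open>g\<close> are found by
  subtraction and multiplication alone. The set \<open>R\<close> is left open because the lemma
  serves for the rationals and for the integers.\<close>

lemma fps_quotient_nth_mem:
  fixes f g :: "'a :: comm_ring_1 fps"
  assumes diff: "\<And>x y. x \<in> R \<Longrightarrow> y \<in> R \<Longrightarrow> x - y \<in> R"
    and mult: "\<And>x y. x \<in> R \<Longrightarrow> y \<in> R \<Longrightarrow> x * y \<in> R"
    and f: "f $ 0 = 1" "\<And>n. f $ n \<in> R" and fg: "\<And>n. (f * g) $ n \<in> R"
  shows "g $ n \<in> R"
proof (induction n rule: less_induct)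
  case (less n)
  \<comment> \<open>The terms are subtracted one at a time, so that closure under differences
    suffices.\<close>
  have "(f * g) $ n - (\<Sum>i\<in>A. f $ i * g $ (n - i)) \<in> R" if "finite A" "A \<subseteq> {1..n}" for A
    using that
  proof (induction A rule: finite_induct)
    case (insert a A)
    have "f $ a * g $ (n - a) \<in> R"
      using insert.prems less by (intro mult f) auto
    from diff[OF insert.IH this] show ?case using insert by (simp add: algebra_simps)
  qed (use fg in simp)
  from this[of "{1..n}"] have "(f * g) $ n - (\<Sum>i=1..n. f $ i * g $ (n - i)) \<in> R" by simp
  also have "(f * g) $ n = g $ n + (\<Sum>i=1..n. f $ i * g $ (n - i))"
    by (simp add: fps_mult_nth sum.atLeast_Suc_atMost f(1))
  finally show ?case by simp
qed

lemma Rats_poly: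
  fixes f :: "'a :: field_char_0 poly"
  assumes "\<And>n. coeff f n \<in> \<rat>"
  obtains g where "f = map_poly of_rat g"
proof
  have "\<exists>r. of_rat r = coeff f n" for n using assms[of n] by (auto elim: Rats_cases)
  hence *: "of_rat (SOME r. of_rat r = coeff f n) = coeff f n" for n by (rule someI_ex)
  show "f = map_poly of_rat (map_poly (\<lambda>x. if x = 0 then 0 else SOME r. of_rat r = x) f)"
    by (rule poly_eqI) (use * in \<open>auto simp: coeff_map_poly\<close>)
qed

text \<open>Orthogonality for the \<open>e\<close>-th roots of unity: unless \<open>z ^ n\<close> is
  1, this is a full geometric sum of ratio \<open>z ^ n\<close>.\<close>

lemma sum_root_unity_powers:
  fixes e n :: nat
  assumes "e > 0"
  defines "z \<equiv> cis (2 * pi / of_nat e)"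
  shows "(\<Sum>j<e. (z ^ j) ^ n) = (if e dvd n then of_nat e else 0)"
proof (cases "e dvd n")
  case True
  have "z ^ e = 1" using assms by (simp add: z_def DeMoivre)
  hence "(z ^ j) ^ n = 1" for j
    using True by (metis dvd_def mult.assoc mult.commute power_mult power_one)
  thus ?thesis using True by simp
next
  case False
  have ze: "z ^ e = 1" using assms by (simp add: z_def DeMoivre)
  have inj: "inj_on (\<lambda>k. cis (2 * pi * real k / real e)) {..<e}"
    using bij_betw_roots_unity[OF assms(1)] by (rule bij_betw_imp_inj_on)
  have zk: "z ^ k = cis (2 * pi * real k / real e)" for k by (simp add: z_def DeMoivre mult.commute)
  have "z ^ n = z ^ (n mod e)"
    by (metis mod_mult_div_eq mult.left_neutral power_add power_mult power_one ze mult.commute)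
  \<comment> \<open>The powers of \<open>z\<close> with exponents below \<open>e\<close> are
    pairwise distinct, and \<open>n mod e\<close> is not 0.\<close>
  also have "\<dots> \<noteq> z ^ 0"
    unfolding zk using inj_onD[OF inj, of "n mod e" 0] assms(1) False by auto
  finally have "z ^ n \<noteq> 1" by simp
  moreover have "(\<Sum>j<e. (z ^ j) ^ n) = (\<Sum>j<e. (z ^ n) ^ j)"
    by (simp flip: power_mult add: mult.commute)
  moreover have "(z ^ n) ^ e = 1"
    using ze by (metis mult.commute power_mult power_one)
  ultimately show ?thesis using False by (simp add: sum_gp_strict)
qed

text \<open>The cofactor is the product of the conjugates \<open>b(\<zeta> X)\<close> over the \<open>e\<close>-th roots of unity
  \<open>\<zeta> \<noteq> 1\<close>; the full product has rational coefficients because its logarithmic derivative has.\<close>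

lemma norm_to_monom:
  fixes b :: "rat poly"
  assumes b0: "coeff b 0 = 1" and e: "e > 0" and l: "has_log_deriv (fps_of_poly b) l"
  obtains b' c where "coeff b' 0 = 1" "coeff c 0 = 1" "b * b' = pcompose c (Polynomial.monom 1 e)"
    "has_log_deriv (fps_of_poly (b * b')) (Abs_fps (\<lambda>n. if e dvd n then of_nat e * l $ n else 0))"
proof -
  define z where "z = cis (2 * pi / of_nat e)"
  define m where "m = Abs_fps (\<lambda>n. if e dvd n then of_nat e * l $ n else 0)"
  define B :: "nat \<Rightarrow> complex poly" where
    "B = (\<lambda>j. pcompose (map_poly of_rat b) [:0, z ^ j:])"
  define lc where "lc = Abs_fps (\<lambda>n. of_rat (l $ n) :: complex)"
  define mc where "mc = Abs_fps (\<lambda>n. of_rat (m $ n) :: complex)"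
  have fB: "fps_of_poly (B j) = fps_of_poly (map_poly of_rat b) oo (fps_const (z ^ j) * fps_X)" for j
    by (simp add: B_def fps_of_poly_pcompose fps_of_poly_pCons mult.commute)
  have fb: "fps_of_poly (map_poly of_rat b) = Abs_fps (\<lambda>n. of_rat (fps_of_poly b $ n) :: complex)"
    by (simp add: fps_eq_iff coeff_map_poly)
  have ldB: "has_log_deriv (fps_of_poly (B j)) (lc oo (fps_const (z ^ j) * fps_X))" for j
    unfolding fB fb lc_def by (intro has_log_deriv_compose_linear of_rat_has_log_deriv l)
  have B0: "coeff (B j) 0 = 1" for j
    using arg_cong[OF fB[of j], of "\<lambda>f. f $ 0"] b0 by (simp add: coeff_map_poly)
  define H where "H = (\<Prod>j<e. B j)"
  define B' where "B' = (\<Prod>j\<in>{1..<e}. B j)"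
  have H: "H = map_poly of_rat b * B'"
  proof -
    have "{..<e} = insert 0 {1..<e}" using e by auto
    moreover have "B 0 = map_poly of_rat b" by (simp add: B_def pcompose_idR)
    ultimately show ?thesis by (simp add: H_def B'_def)
  qed
  \<comment> \<open>By orthogonality the sum over the conjugates keeps the coefficients at multiples
    of \<open>e\<close>, multiplied by \<open>e\<close>.\<close>
  have "(\<Sum>j<e. lc oo (fps_const (z ^ j) * fps_X)) = mc"
    using sum_root_unity_powers[OF e]
    by (auto simp: fps_eq_iff fps_sum_nth fps_compose_linear lc_def mc_def m_def z_def of_rat_mult
             simp flip: sum_distrib_right)
  hence ldH: "has_log_deriv (fps_of_poly H) mc"
    unfolding H_def fps_of_poly_prod
    using has_log_deriv_prod[of "{..<e}" "\<lambda>j. fps_of_poly (B j)", OF ldB] by simp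
  have coeff0_prod: "coeff (prod B A) 0 = 1" for A
    by (induction A rule: infinite_finite_induct) (auto simp: coeff_mult_0 B0)
  have "coeff H n \<in> \<rat>" for n
    using has_log_deriv_Rats[OF ldH, of n] by (simp add: H_def coeff0_prod mc_def)
  then obtain h where h: "H = map_poly of_rat h" by (rule Rats_poly)
  \<comment> \<open>The cofactor is a quotient of two series with rational coefficients, the divisor
    having constant term 1.\<close>
  have "fps_of_poly B' $ n \<in> \<rat>" for n
    by (rule fps_quotient_nth_mem[of "\<rat>" "fps_of_poly (map_poly of_rat b)"])
       (auto simp: coeff_map_poly b0 h simp flip: fps_of_poly_mult H)
  hence "coeff B' n \<in> \<rat>" for n by simp
  then obtain b' where b': "B' = map_poly of_rat b'" by (rule Rats_poly)
  have hb: "h = b * b'"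
  proof (rule poly_eqI)
    fix n
    have "of_rat (coeff h n) = (of_rat (coeff (b * b') n) :: complex)"
      using arg_cong[OF H, of "\<lambda>f. coeff f n"]
      by (simp add: h b' coeff_map_poly coeff_mult of_rat_sum of_rat_mult)
    thus "coeff h n = coeff (b * b') n" by simp
  qed
  have b'0: "coeff b' 0 = 1"
    using coeff0_prod[of "{1..<e}"] b' by (simp add: B'_def[symmetric] coeff_map_poly del: One_nat_def)
  have ldh: "has_log_deriv (fps_of_poly h) m"
  proof (rule has_log_derivI)
    fix n
    have "of_rat (of_nat n * fps_of_poly h $ n) =
        (of_rat (\<Sum>i = 0..n. fps_of_poly h $ i * m $ (n - i)) :: complex)"
      using has_log_deriv_nth[OF ldH, of n]
      by (simp add: h mc_def coeff_map_poly of_rat_mult of_rat_sum)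
    thus "of_nat n * fps_of_poly h $ n = (\<Sum>i = 0..n. fps_of_poly h $ i * m $ (n - i))"
      by (simp only: of_rat_eq_iff)
  qed
  have h0: "coeff h 0 = 1" by (simp add: hb coeff_mult_0 b0 b'0)
  have "coeff h n = 0" if "\<not> e dvd n" for n
    using has_log_deriv_supported[OF ldh _ _ that] h0 by (simp add: m_def)
  then obtain c where c: "h = pcompose c (Polynomial.monom 1 e)"
    using poly_in_monom[OF e, of h] by blast
  have "coeff c 0 = 1" using h0 e by (simp add: c poly_0_coeff_0)
  with b'0 c hb ldh show thesis using that by (simp add: m_def)
qed

text \<open>The rational functions in \<open>X^e\<close> with value \<open>1\<close> at \<open>0\<close>, as power series.\<close>

definition rat_funs :: "nat \<Rightarrow> rat fps set" where
  "rat_funs e = {f. \<exists>a b. coeff a 0 = 1 \<and> coeff b 0 = 1 \<and>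
     f * fps_of_poly (pcompose b (Polynomial.monom 1 e)) =
       fps_of_poly (pcompose a (Polynomial.monom 1 e))}"

lemma rat_funs_nth_0:
  assumes "f \<in> rat_funs e" "e > 0"
  shows "f $ 0 = 1"
proof -
  obtain a b where ab: "coeff a 0 = 1" "coeff b 0 = 1"
    "f * fps_of_poly (pcompose b (Polynomial.monom 1 e)) =
       fps_of_poly (pcompose a (Polynomial.monom 1 e))"
    using assms(1) by (auto simp: rat_funs_def)
  from arg_cong[OF ab(3), of "\<lambda>f. f $ 0"] show ?thesis
    using ab(1,2) assms(2) by (simp add: poly_0_coeff_0)
qed

lemma rat_funs_1: "1 \<in> rat_funs e"
  by (auto simp: rat_funs_def intro!: exI[of _ 1] simp: pcompose_1)

lemma rat_funs_mult:
  assumes "f \<in> rat_funs e" "g \<in> rat_funs e"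
  shows "f * g \<in> rat_funs e"
proof -
  obtain a b where ab: "coeff a 0 = 1" "coeff b 0 = 1"
    "f * fps_of_poly (pcompose b (Polynomial.monom 1 e)) =
       fps_of_poly (pcompose a (Polynomial.monom 1 e))"
    using assms(1) by (auto simp: rat_funs_def)
  obtain c d where cd: "coeff c 0 = 1" "coeff d 0 = 1"
    "g * fps_of_poly (pcompose d (Polynomial.monom 1 e)) =
       fps_of_poly (pcompose c (Polynomial.monom 1 e))"
    using assms(2) by (auto simp: rat_funs_def)
  have "f * g * fps_of_poly (pcompose (b * d) (Polynomial.monom 1 e)) =
      (f * fps_of_poly (pcompose b (Polynomial.monom 1 e))) *
      (g * fps_of_poly (pcompose d (Polynomial.monom 1 e)))"
    by (simp add: pcompose_mult fps_of_poly_mult algebra_simps)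
  also have "\<dots> = fps_of_poly (pcompose (a * c) (Polynomial.monom 1 e))"
    unfolding ab(3) cd(3) by (simp add: pcompose_mult fps_of_poly_mult)
  finally show ?thesis
    using ab(1,2) cd(1,2) unfolding rat_funs_def mem_Collect_eq
    by (intro exI[of _ "a * c"] exI[of _ "b * d"] conjI) (simp_all add: coeff_mult_0)
qed

lemma rat_funs_inverse:
  assumes "f \<in> rat_funs e" "e > 0"
  shows "inverse f \<in> rat_funs e"
proof -
  obtain a b where ab: "coeff a 0 = 1" "coeff b 0 = 1"
    "f * fps_of_poly (pcompose b (Polynomial.monom 1 e)) =
       fps_of_poly (pcompose a (Polynomial.monom 1 e))"
    using assms(1) by (auto simp: rat_funs_def)
  have "inverse f * f = 1" using rat_funs_nth_0[OF assms] by (intro inverse_mult_eq_1) auto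
  hence "inverse f * fps_of_poly (pcompose a (Polynomial.monom 1 e)) =
      fps_of_poly (pcompose b (Polynomial.monom 1 e))"
    by (simp flip: ab(3) mult.assoc)
  thus ?thesis using ab unfolding rat_funs_def by blast
qed

lemma rat_funs_power: "f \<in> rat_funs e \<Longrightarrow> f ^ n \<in> rat_funs e"
  by (induction n) (auto intro: rat_funs_1 rat_funs_mult)

lemma rat_funs_subset:
  assumes "e > 0"
  shows "rat_funs e \<subseteq> rat_funs 1"
proof
  fix f assume "f \<in> rat_funs e"
  then obtain a b where ab: "coeff a 0 = 1" "coeff b 0 = 1"
    "f * fps_of_poly (pcompose b (Polynomial.monom 1 e)) =
       fps_of_poly (pcompose a (Polynomial.monom 1 e))"
    by (auto simp: rat_funs_def)
  have X: "Polynomial.monom (1::rat) 1 = [:0, 1:]" by (simp add: monom_altdef)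
  show "f \<in> rat_funs 1"
    using ab assms unfolding rat_funs_def mem_Collect_eq
    by (intro exI[of _ "pcompose a (Polynomial.monom 1 e)"]
          exI[of _ "pcompose b (Polynomial.monom 1 e)"] conjI)
       (simp_all add: poly_0_coeff_0 X pcompose_idR del: One_nat_def)
qed

lemma rat_funs_1E:
  assumes "f \<in> rat_funs 1"
  obtains a b where "coeff a 0 = 1" "coeff b 0 = 1" "f * fps_of_poly b = fps_of_poly a"
proof -
  have X: "Polynomial.monom (1::rat) 1 = [:0, 1:]" by (simp add: monom_altdef)
  show thesis
    using assms that by (auto simp: rat_funs_def X pcompose_idR simp del: One_nat_def)
qed

lemma rat_funs_1I:
  assumes "f * fps_of_poly b = fps_of_poly a" "coeff a 0 = 1" "coeff b 0 = 1"
  shows "f \<in> rat_funs 1"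
proof -
  have monom_1: "Polynomial.monom (1::rat) 1 = [:0, 1:]" by (simp add: monom_altdef)
  show ?thesis
    using assms unfolding rat_funs_def monom_1 pcompose_idR by blast
qed

text \<open>\<open>N\<close> is the norm of the numerator divided by the norm of the denominator.
  The numerator has logarithmic derivative \<open>l + lb\<close>, and the division removes the
  contribution of \<open>lb\<close>.\<close>

lemma rat_funs_norm:
  assumes "f \<in> rat_funs 1" "has_log_deriv f l" "e > 0"
  obtains N where "N \<in> rat_funs e"
    "has_log_deriv N (Abs_fps (\<lambda>n. if e dvd n then of_nat e * l $ n else 0))"
proof -
  obtain a b where ab: "coeff a 0 = 1" "coeff b 0 = 1" "f * fps_of_poly b = fps_of_poly a"
    using assms(1) by (rule rat_funs_1E)
  have "fps_of_poly b \<noteq> 0" using ab(2) by (metis coeff_0 fps_of_poly_0 fps_of_poly_nth zero_neq_one fps_zero_nth)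
  then obtain lb where lb: "has_log_deriv (fps_of_poly b) lb"
    using has_log_deriv_ex by blast
  hence la: "has_log_deriv (fps_of_poly a) (l + lb)"
    using has_log_deriv_mult[OF assms(2) lb] ab(3) by simp
  define n where "n = (\<lambda>l::rat fps. Abs_fps (\<lambda>n. if e dvd n then of_nat e * l $ n else 0))"
  obtain b' c where b': "coeff b' 0 = 1" "coeff c 0 = 1"
      "b * b' = pcompose c (Polynomial.monom 1 e)" "has_log_deriv (fps_of_poly (b * b')) (n lb)"
    using norm_to_monom[OF ab(2) assms(3) lb] unfolding n_def by blast
  obtain a' d where a': "coeff a' 0 = 1" "coeff d 0 = 1"
      "a * a' = pcompose d (Polynomial.monom 1 e)"
      "has_log_deriv (fps_of_poly (a * a')) (n (l + lb))"
    using norm_to_monom[OF ab(1) assms(3) la] unfolding n_def by blast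
  have bb0: "fps_of_poly (b * b') $ 0 = 1" using ab(2) b'(1) by (simp add: coeff_mult_0)
  define N where "N = fps_of_poly (a * a') * inverse (fps_of_poly (b * b'))"
  have N: "N * fps_of_poly (b * b') = fps_of_poly (a * a')"
    using bb0 inverse_mult_eq_1[of "fps_of_poly (b * b')"] unfolding N_def mult.assoc by simp
  have "N \<in> rat_funs e"
    unfolding rat_funs_def mem_Collect_eq using N a'(2) b'(2) unfolding a'(3) b'(3) by blast
  moreover have "n (l + lb) + - n lb = n l"
    by (auto simp: n_def fps_eq_iff algebra_simps)
  hence "has_log_deriv N (n l)"
    using has_log_deriv_mult[OF a'(4) has_log_deriv_inverse[OF b'(4)]] bb0
    by (simp add: N_def)
  ultimately show thesis using that by (simp add: n_def)
qed

text \<open>The cofactor \<open>b'\<close> turns the denominator into a polynomial in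
  \<open>X^e\<close>. The new numerator then has a logarithmic derivative supported on multiples of
  \<open>e\<close>, so it is such a polynomial as well.\<close>

lemma rat_funs_supported:
  assumes "f \<in> rat_funs 1" "has_log_deriv f l" "e > 0" "\<And>n. \<not> e dvd n \<Longrightarrow> l $ n = 0"
  shows "f \<in> rat_funs e"
proof -
  obtain a b where ab: "coeff a 0 = 1" "coeff b 0 = 1" "f * fps_of_poly b = fps_of_poly a"
    using assms(1) by (rule rat_funs_1E)
  have "fps_of_poly b \<noteq> 0" using ab(2) by (metis coeff_0 fps_of_poly_0 fps_of_poly_nth zero_neq_one fps_zero_nth)
  then obtain lb where lb: "has_log_deriv (fps_of_poly b) lb"
    using has_log_deriv_ex by blast
  define n where "n = Abs_fps (\<lambda>n. if e dvd n then of_nat e * lb $ n else 0)"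
  obtain b' c where b': "coeff b' 0 = 1" "coeff c 0 = 1"
      "b * b' = pcompose c (Polynomial.monom 1 e)" "has_log_deriv (fps_of_poly (b * b')) n"
    using norm_to_monom[OF ab(2) assms(3) lb] unfolding n_def by blast
  have f: "f * fps_of_poly (b * b') = fps_of_poly (a * b')"
    by (simp add: fps_of_poly_mult flip: ab(3) mult.assoc)
  have ld: "has_log_deriv (fps_of_poly (a * b')) (l + n)"
    using has_log_deriv_mult[OF assms(2) b'(4)] f by simp
  have "coeff (a * b') i = 0" if "\<not> e dvd i" for i
    using has_log_deriv_supported[OF ld _ _ that] ab(1) b'(1) assms(4)
    by (simp add: coeff_mult_0 n_def)
  then obtain d where d: "a * b' = pcompose d (Polynomial.monom 1 e)"
    using poly_in_monom[OF assms(3), of "a * b'"] by blast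
  have "coeff d 0 = 1"
    using arg_cong[OF d, of "\<lambda>f. coeff f 0"] ab(1) b'(1) assms(3)
    by (simp add: coeff_mult_0 poly_0_coeff_0)
  thus ?thesis
    using b'(2) f unfolding d b'(3) rat_funs_def mem_Collect_eq by blast
qed

section \<open>Products of rational functions over a set of exponents\<close>

definition rat_fun_prods :: "nat set \<Rightarrow> rat fps set" where
  "rat_fun_prods P = {f. \<exists>F. (\<forall>e\<in>P. F e \<in> rat_funs e) \<and> f = (\<Prod>e\<in>P. F e)}"

lemma rat_fun_prods_1: "1 \<in> rat_fun_prods P"
  unfolding rat_fun_prods_def mem_Collect_eq
  by (intro exI[of _ "\<lambda>_. 1"]) (simp add: rat_funs_1)

lemma rat_fun_prods_mult:
  assumes "f \<in> rat_fun_prods P" "g \<in> rat_fun_prods P"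
  shows "f * g \<in> rat_fun_prods P"
proof -
  obtain F G where "\<forall>e\<in>P. F e \<in> rat_funs e" "f = prod F P" "\<forall>e\<in>P. G e \<in> rat_funs e" "g = prod G P"
    using assms by (auto simp: rat_fun_prods_def)
  thus ?thesis unfolding rat_fun_prods_def mem_Collect_eq
    by (intro exI[of _ "\<lambda>e. F e * G e"]) (simp add: rat_funs_mult prod.distrib)
qed

lemma rat_fun_prods_power: "f \<in> rat_fun_prods P \<Longrightarrow> f ^ n \<in> rat_fun_prods P"
  by (induction n) (auto intro: rat_fun_prods_1 rat_fun_prods_mult)

lemma rat_fun_prods_insert:
  assumes "f \<in> rat_funs e" "g \<in> rat_fun_prods P" "e \<notin> P" "finite P"
  shows "f * g \<in> rat_fun_prods (insert e P)"
proof -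
  obtain G where G: "\<forall>e\<in>P. G e \<in> rat_funs e" "g = prod G P"
    using assms(2) by (auto simp: rat_fun_prods_def)
  have "prod G P = prod (G(e := f)) P"
    using assms(3) by (intro prod.cong) auto
  thus ?thesis
    using G assms unfolding rat_fun_prods_def mem_Collect_eq
    by (intro exI[of _ "G(e := f)"]) simp
qed

lemma rat_fun_prods_nth_0:
  assumes "f \<in> rat_fun_prods P" "\<And>e. e \<in> P \<Longrightarrow> e > 0"
  shows "f $ 0 = 1"
proof -
  obtain F where F: "\<forall>e\<in>P. F e \<in> rat_funs e" "f = prod F P"
    using assms(1) by (auto simp: rat_fun_prods_def)
  have "prod F P $ 0 = (\<Prod>e\<in>P. F e $ 0)"
    by (induction P rule: infinite_finite_induct) auto
  also have "\<dots> = 1" using F(1) rat_funs_nth_0 assms(2) by (intro prod.neutral) blast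
  finally show ?thesis by (simp add: F(2))
qed

lemma rat_fun_prods_inverse:
  assumes "f \<in> rat_fun_prods P" "\<And>e. e \<in> P \<Longrightarrow> e > 0"
  shows "inverse f \<in> rat_fun_prods P"
proof -
  obtain F where F: "\<forall>e\<in>P. F e \<in> rat_funs e" "f = prod F P"
    using assms(1) by (auto simp: rat_fun_prods_def)
  have G: "(\<Prod>e\<in>P. inverse (F e)) \<in> rat_fun_prods P"
    unfolding rat_fun_prods_def mem_Collect_eq using F(1) assms(2)
    by (intro exI[of _ "\<lambda>e. inverse (F e)"]) (simp add: rat_funs_inverse)
  have "F e * inverse (F e) = 1" if "e \<in> P" for e
    using rat_funs_nth_0[of "F e" e] that F(1) assms(2) inverse_mult_eq_1[of "F e"]
    by (simp add: mult.commute)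
  hence "f * (\<Prod>e\<in>P. inverse (F e)) = 1"
    unfolding F(2) prod.distrib[symmetric] by simp
  moreover have "inverse f * f = 1"
    using rat_fun_prods_nth_0[OF assms] by (intro inverse_mult_eq_1) auto
  ultimately have "inverse f = (\<Prod>e\<in>P. inverse (F e))"
    using mult.assoc[of "inverse f" f "\<Prod>e\<in>P. inverse (F e)"] by simp
  thus ?thesis using G by simp
qed

text \<open>Divides out, one after another, the norms to \<open>X^e\<close>: each norm removes the terms at multiples
  of \<open>e\<close> from the logarithmic derivative, at the price of an \<open>e\<close>-th power.\<close>

lemma sieve_log_deriv:
  assumes "finite J" "\<And>e. e \<in> J \<Longrightarrow> e > 0" "f \<in> rat_funs 1" "has_log_deriv f l"
  shows "\<exists>g\<in>rat_funs 1. \<exists>h\<in>rat_fun_prods J. f ^ \<Prod>J = g * h \<and>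
    has_log_deriv g (Abs_fps (\<lambda>n. if \<exists>e\<in>J. e dvd n then 0 else of_nat (\<Prod>J) * l $ n))"
  using assms(1,2)
proof (induction J rule: finite_induct)
  case empty
  have "Abs_fps (\<lambda>n. l $ n) = l" by (simp add: fps_eq_iff)
  thus ?case
    using assms(3,4) rat_fun_prods_1 by (intro bexI[of _ f] bexI[of _ 1]) simp_all
next
  case (insert e J)
  define lg where "lg = Abs_fps (\<lambda>n. if \<exists>e\<in>J. e dvd n then 0 else of_nat (\<Prod>J) * l $ n)"
  obtain g h where gh: "g \<in> rat_funs 1" "h \<in> rat_fun_prods J" "f ^ \<Prod>J = g * h"
      "has_log_deriv g lg"
    using insert unfolding lg_def by auto
  have e: "e > 0" using insert.prems by simp
  define ln where "ln = Abs_fps (\<lambda>n. if e dvd n then of_nat e * lg $ n else 0)"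
  obtain N where N: "N \<in> rat_funs e" "has_log_deriv N ln"
    using rat_funs_norm[OF gh(1,4) e] unfolding ln_def by blast
  have N0: "N $ 0 = 1" using rat_funs_nth_0[OF N(1) e] .
  have NN: "inverse N * N = 1" using N0 by (intro inverse_mult_eq_1) auto
  \<comment> \<open>At multiples of \<open>e\<close> the two terms cancel; elsewhere
    \<open>ln\<close> vanishes and \<open>e\<close> joins the product of the exponents.\<close>
  have eq: "of_nat e * lg + - ln =
      Abs_fps (\<lambda>n. if \<exists>e\<in>insert e J. e dvd n then 0 else of_nat (\<Prod>(insert e J)) * l $ n)"
    using insert.hyps by (auto simp: fps_eq_iff ln_def lg_def fps_of_nat[symmetric])
  have "\<Prod>(insert e J) = \<Prod>J * e" using insert.hyps by (simp add: mult.commute)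
  hence "f ^ \<Prod>(insert e J) = (g * h) ^ e"
    by (simp only: power_mult gh(3))
  also have "\<dots> = g ^ e * h ^ e * (inverse N * N)"
    unfolding NN by (simp add: power_mult_distrib)
  also have "\<dots> = (g ^ e * inverse N) * (N * h ^ e)"
    by (simp only: mult_ac)
  finally have "f ^ \<Prod>(insert e J) = (g ^ e * inverse N) * (N * h ^ e)" .
  moreover have "inverse N \<in> rat_funs 1"
    using rat_funs_inverse[OF N(1) e] rat_funs_subset[OF e] by blast
  hence "g ^ e * inverse N \<in> rat_funs 1"
    using gh(1) by (intro rat_funs_mult rat_funs_power)
  moreover have "N * h ^ e \<in> rat_fun_prods (insert e J)"
    using insert.hyps gh(2) N(1) by (intro rat_fun_prods_insert rat_fun_prods_power)
  moreover have "has_log_deriv (g ^ e * inverse N) (of_nat e * lg + - ln)"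
    using N0 by (intro has_log_deriv_mult has_log_deriv_power has_log_deriv_inverse gh N) auto
  ultimately show ?case unfolding eq by blast
qed

text \<open>The exponents \<open>n\<close> for which \<open>f ^ n\<close> decomposes are multiples
  of the least positive one. Among them are the products of all primes of \<open>P\<close> but one,
  and no prime divides all of these, so the least one is 1.\<close>

lemma rat_fun_prods_if_log_deriv:
  assumes P: "finite P" "P \<noteq> {}" "\<And>q. q \<in> P \<Longrightarrow> prime q"
    and f: "f \<in> rat_funs 1" "has_log_deriv f l"
    and l: "\<And>n. (\<And>q. q \<in> P \<Longrightarrow> \<not> q dvd n) \<Longrightarrow> l $ n = 0"
  shows "f \<in> rat_fun_prods P"
proof -
  have pos: "q > 0" if "q \<in> P" for q using P(3)[OF that] by (rule prime_gt_0_nat)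
  define T where "T = {n. f ^ n \<in> rat_fun_prods P}"
  have T: "\<Prod>(P - {q}) \<in> T" if q: "q \<in> P" for q
  proof -
    obtain g h where gh: "g \<in> rat_funs 1" "h \<in> rat_fun_prods (P - {q})" "f ^ \<Prod>(P - {q}) = g * h"
      "has_log_deriv g (Abs_fps (\<lambda>n. if \<exists>e\<in>P - {q}. e dvd n then 0
          else of_nat (\<Prod>(P - {q})) * l $ n))"
      using sieve_log_deriv[of "P - {q}" f l] P(1) pos f by blast
    \<comment> \<open>The terms left in the logarithmic derivative of \<open>g\<close> avoid the
      multiples of all primes other than \<open>q\<close>; there \<open>l\<close> vanishes unless
      \<open>q\<close> divides the index.\<close>
    have "g \<in> rat_funs q"
      by (rule rat_funs_supported[OF gh(1,4)]) (use pos q l in auto)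
    hence "g * h \<in> rat_fun_prods (insert q (P - {q}))"
      using gh(2) P(1) by (intro rat_fun_prods_insert) auto
    thus ?thesis using gh(3) q by (simp add: T_def insert_absorb)
  qed
  define D where "D = (LEAST n. n > 0 \<and> n \<in> T)"
  obtain q0 where q0: "q0 \<in> P" using P(2) by blast
  have "\<Prod>(P - {q0}) > 0" using pos by (intro prod_pos) auto
  hence "D > 0 \<and> D \<in> T" unfolding D_def using T[OF q0] by (intro LeastI) auto
  hence D: "D > 0" "D \<in> T" by auto
  have dvd: "D dvd n" if "n \<in> T" for n
  proof (rule ccontr)
    assume "\<not> D dvd n"
    hence r: "n mod D > 0" "n mod D < D" using D(1) by (auto simp: mod_greater_zero_iff_not_dvd)
    have "f $ 0 = 1" using rat_funs_nth_0[OF f(1)] by simp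
    hence "(f ^ D) $ 0 = 1" by (rule fps_power_zeroth_eq_one)
    hence inv: "inverse (f ^ D) * f ^ D = 1" by (intro inverse_mult_eq_1) auto
    \<comment> \<open>Division with remainder in the exponent: the remainder again lies in
      \<open>T\<close>, yet it is below the least positive element \<open>D\<close>.\<close>
    have "f ^ n = f ^ (n mod D) * (f ^ D) ^ (n div D)"
      by (simp flip: power_mult power_add)
    hence "f ^ n * inverse (f ^ D) ^ (n div D) =
        f ^ (n mod D) * (inverse (f ^ D) * f ^ D) ^ (n div D)"
      by (simp only: power_mult_distrib mult_ac)
    hence "f ^ n * inverse (f ^ D) ^ (n div D) = f ^ (n mod D)"
      unfolding inv by simp
    moreover have "inverse (f ^ D) \<in> rat_fun_prods P"
      using D(2) pos unfolding T_def by (intro rat_fun_prods_inverse) auto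
    hence "f ^ n * inverse (f ^ D) ^ (n div D) \<in> rat_fun_prods P"
      using that unfolding T_def by (auto intro: rat_fun_prods_mult rat_fun_prods_power)
    ultimately have "n mod D \<in> T" by (simp add: T_def)
    thus False using r not_less_Least[of "n mod D" "\<lambda>n. n > 0 \<and> n \<in> T"] by (simp add: D_def)
  qed
  have "D = 1"
  proof (rule ccontr)
    assume "D \<noteq> 1"
    then obtain s where s: "prime s" "s dvd D" by (metis prime_factor_nat)
    \<comment> \<open>A prime divisor \<open>s\<close> of \<open>D\<close> divides every product
      with one prime left out, so it is in \<open>P\<close>; leaving out \<open>s\<close> itself
      then gives a contradiction.\<close>
    have "\<exists>q\<in>P - {q1}. s = q" if "q1 \<in> P" for q1
    proof -
      have "s dvd \<Prod>(P - {q1})" using s(2) dvd[OF T[OF that]] by (rule dvd_trans)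
      then obtain q where "q \<in> P - {q1}" "s dvd q"
        using s(1) P(1) by (auto simp: prime_dvd_prod_iff)
      thus ?thesis using s(1) P(3) primes_dvd_imp_eq by blast
    qed
    thus False using q0 by blast
  qed
  thus ?thesis using D(2) by (simp add: T_def)
qed

section \<open>Frobenius-stable multisets\<close>

lemma frob_add: "(x + y :: F2bar) ^ 2 ^ n = x ^ 2 ^ n + y ^ 2 ^ n"
  using freshmans_dream'[where ?'a = F2bar, of "2 ^ n" n x y] by simp

lemma frob_sum_mset: "(\<Sum>x\<in>#M. f x :: F2bar) ^ 2 ^ n = (\<Sum>x\<in>#M. f x ^ 2 ^ n)"
  by (induction M) (auto simp: frob_add)

lemma frob_inject: "(x :: F2bar) ^ 2 ^ n = y ^ 2 ^ n \<longleftrightarrow> x = y"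
proof
  assume "x ^ 2 ^ n = y ^ 2 ^ n"
  hence "(x - y) ^ 2 ^ n + y ^ 2 ^ n = y ^ 2 ^ n"
    using frob_add[of "x - y" y n] by simp
  thus "x = y" by simp
qed simp

lemma frob_frob: "((x :: F2bar) ^ 2 ^ i) ^ 2 ^ j = x ^ 2 ^ (i + j)"
  by (simp add: power_add power_mult)

lemma frob_fixed_iff: "(x :: F2bar) ^ 2 = x \<longleftrightarrow> x \<in> range to_ac"
proof
  assume "x ^ 2 = x"
  hence "x * (x - 1) = 0" by (simp add: power2_eq_square algebra_simps)
  hence "x = to_ac 0 \<or> x = to_ac 1" by auto
  thus "x \<in> range to_ac" by blast
next
  assume "x \<in> range to_ac"
  then obtain b where "x = to_ac b" by blast
  thus "x ^ 2 = x" by (cases b) auto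
qed

definition curve_fun :: "nat \<Rightarrow> F2bar \<Rightarrow> F2bar" where
  "curve_fun k x = x ^ (2 ^ k + 1) + inverse x"

lemma curve_fun_frob: "curve_fun k (x ^ 2 ^ n) = curve_fun k x ^ 2 ^ n"
  by (simp add: curve_fun_def frob_add power_inverse power_mult_distrib flip: power_mult)
     (simp add: mult.commute)

text \<open>A monic polynomial over the prime field with nonzero constant term is represented by the
  multiset of its roots in \<open>F2bar\<close>.\<close>

definition frob_msets :: "nat \<Rightarrow> F2bar multiset set" where
  "frob_msets d = {M. size M = d \<and> 0 \<notin># M \<and> image_mset (\<lambda>x. x ^ 2) M = M}"

text \<open>For a Frobenius-stable multiset the sum lies in the prime field, so \<open>of_ac\<close>
  loses nothing. Composed with \<open>sign_char\<close> it becomes a multiplicative character on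
  monic polynomials.\<close>

definition mset_val :: "nat \<Rightarrow> F2bar multiset \<Rightarrow> bit" where
  "mset_val k M = of_ac (\<Sum>x\<in>#M. curve_fun k x)"

text \<open>Squaring permutes the summands, so their sum is fixed by Frobenius.\<close>

lemma to_ac_mset_val:
  assumes "image_mset (\<lambda>x. x ^ 2) M = M"
  shows "to_ac (mset_val k M) = (\<Sum>x\<in>#M. curve_fun k x)"
proof -
  have "(\<Sum>x\<in>#M. curve_fun k x) ^ 2 = (\<Sum>x\<in>#M. curve_fun k (x ^ 2))"
    using frob_sum_mset[of "curve_fun k" M 1] curve_fun_frob[of k _ 1] by simp
  also have "\<dots> = (\<Sum>x\<in>#image_mset (\<lambda>x. x ^ 2) M. curve_fun k x)"
    by (simp add: image_mset.compositionality o_def)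
  finally have "(\<Sum>x\<in>#M. curve_fun k x) \<in> range to_ac"
    unfolding assms frob_fixed_iff .
  thus ?thesis unfolding mset_val_def by (rule to_ac_of_ac)
qed

lemma mset_val_union:
  assumes "image_mset (\<lambda>x. x ^ 2) M = M" "image_mset (\<lambda>x. x ^ 2) N = N"
  shows "mset_val k (M + N) = mset_val k M + mset_val k N"
proof -
  have "to_ac (mset_val k (M + N)) = to_ac (mset_val k M + mset_val k N)"
    using assms by (simp only: to_ac_mset_val to_ac_add image_mset_union sum_mset.union)
  thus ?thesis unfolding to_ac_eq_iff .
qed

lemma sign_char_add: "sign_char (a + b) = sign_char a * sign_char b"
  by (cases a; cases b) (auto simp: sign_char_def)

text \<open>For \<open>x\<close> in \<open>GF2 i\<close> with \<open>i > 0\<close>, these are the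
  roots of the characteristic polynomial of multiplication by \<open>x\<close> on that field.
  Repetitions are kept, so the size is always \<open>i\<close>.\<close>

definition frob_orbit :: "nat \<Rightarrow> F2bar \<Rightarrow> F2bar multiset" where
  "frob_orbit i x = image_mset (\<lambda>j. x ^ 2 ^ j) (mset_set {..<i})"

lemma size_frob_orbit [simp]: "size (frob_orbit i x) = i"
  by (simp add: frob_orbit_def)

lemma frob_orbit_0 [simp]: "frob_orbit 0 x = {#}"
  by (simp add: frob_orbit_def)

lemma frob_orbit_Suc: "frob_orbit (Suc i) x = add_mset (x ^ 2 ^ i) (frob_orbit i x)"
  by (simp add: frob_orbit_def lessThan_Suc)

lemma frob_orbit_stable:
  assumes "x \<in> GF2 i"
  shows "image_mset (\<lambda>x. x ^ 2) (frob_orbit i x) = frob_orbit i x"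
proof -
  \<comment> \<open>Squaring shifts the orbit by one place. For \<open>x\<close> in
    \<open>GF2 i\<close> the entry gained at the end is the entry \<open>x\<close> lost at the
    front.\<close>
  have "add_mset x (image_mset (\<lambda>x. x ^ 2) (frob_orbit i x)) = frob_orbit (Suc i) x" for i
  proof (induction i)
    case (Suc i)
    have "(x ^ 2 ^ i) ^ 2 = x ^ 2 ^ Suc i" using frob_frob[of x i 1] by simp
    thus ?case using Suc
      by (simp only: frob_orbit_Suc image_mset_add_mset add_mset_commute[of x])
  qed (simp add: frob_orbit_Suc)
  from this[of i] show ?thesis
    using assms by (simp add: frob_orbit_Suc GF2_def)
qed

lemma zero_notin_frob_orbit: "x \<noteq> 0 \<Longrightarrow> 0 \<notin># frob_orbit i x"
  by (auto simp: frob_orbit_def)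

text \<open>This ties the character on stable multisets to the terms of the exponential sum.\<close>

lemma mset_val_frob_orbit: "mset_val k (frob_orbit i x) = Tr i (curve_fun k x)"
  by (simp add: mset_val_def Tr_def frob_orbit_def image_mset.compositionality o_def
        curve_fun_frob sum_unfold_sum_mset)

lemma count_frob:
  fixes x :: F2bar
  assumes "image_mset (\<lambda>x. x ^ 2) M = M"
  shows "count M (x ^ 2 ^ j) = count M x"
proof (induction j)
  case (Suc j)
  have "y ^ 2 = (x ^ 2 ^ j) ^ 2 \<longleftrightarrow> y = x ^ 2 ^ j" for y :: F2bar
    using frob_inject[of y 1 "x ^ 2 ^ j"] by simp
  hence "(\<lambda>x. x ^ 2) -` {(x ^ 2 ^ j) ^ 2} = {x ^ 2 ^ j}" by auto
  hence "count (image_mset (\<lambda>x. x ^ 2) M) ((x ^ 2 ^ j) ^ 2) = count M (x ^ 2 ^ j)"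
    by (cases "x ^ 2 ^ j \<in># M") (auto simp: count_image_mset not_in_iff)
  thus ?case unfolding assms Suc by (simp flip: power_mult add: mult.commute)
qed simp

text \<open>With \<open>\<delta>\<close> the degree of \<open>x\<close> over the prime field, \<open>x \<in> GF2 i\<close> forces \<open>i = \<delta> j\<close>, and then
  \<open>frob_orbit i x\<close> consists of the \<open>\<delta>\<close> conjugates of \<open>x\<close>, each with multiplicity \<open>j\<close>.\<close>

lemma card_frob_orbits_within:
  fixes x :: F2bar
  assumes M: "image_mset (\<lambda>x. x ^ 2) M = M" and x: "x \<in># M"
  shows "card {i. i > 0 \<and> x \<in> GF2 i \<and> frob_orbit i x \<subseteq># M} = count M x"
proof -
  have "x ^ 2 ^ j \<in># M" for j
    using x by (simp only: count_greater_zero_iff[symmetric] count_frob[OF M])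
  hence "range (\<lambda>j::nat. x ^ 2 ^ j) \<subseteq> set_mset M" by blast
  hence fin: "finite (range (\<lambda>j::nat. x ^ 2 ^ j))" by (rule finite_subset) simp
  \<comment> \<open>All iterates of \<open>x\<close> lie in \<open>M\<close>, which has finitely
    many elements, so two of them coincide and \<open>x\<close> is periodic under Frobenius.\<close>
  have "\<not> inj (\<lambda>j::nat. x ^ 2 ^ j)"
    using finite_imageD[OF fin] infinite_UNIV_nat by blast
  then obtain i j :: nat where ij: "i < j" "x ^ 2 ^ i = x ^ 2 ^ j"
    using linorder_injI[of "\<lambda>j::nat. x ^ 2 ^ j"] by blast
  have period: "x ^ 2 ^ (j - i) = x" if "i \<le> j" "x ^ 2 ^ i = x ^ 2 ^ j" for i j
  proof -
    have "(x ^ 2 ^ (j - i)) ^ 2 ^ i = x ^ 2 ^ i"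
      unfolding frob_frob that(2) using that(1) by (simp only: le_add_diff_inverse2)
    thus ?thesis unfolding frob_inject .
  qed
  define per where "per d \<longleftrightarrow> d > 0 \<and> x ^ 2 ^ d = x" for d :: nat
  define \<delta> where "\<delta> = (LEAST d. per d)"
  have "per (j - i)" unfolding per_def using ij(1) period[OF _ ij(2)] by simp
  hence "per \<delta>" unfolding \<delta>_def by (rule LeastI)
  hence \<delta>: "\<delta> > 0" "x ^ 2 ^ \<delta> = x" by (simp_all only: per_def)
  have min: "\<delta> \<le> d" if "d > 0" "x ^ 2 ^ d = x" for d
    unfolding \<delta>_def by (rule Least_le) (simp only: per_def that)
  have mult: "x ^ 2 ^ (\<delta> * j) = x" for j
  proof (induction j)
    case (Suc j)
    have "x ^ 2 ^ (\<delta> * Suc j) = (x ^ 2 ^ \<delta>) ^ 2 ^ (\<delta> * j)" by (simp only: frob_frob mult_Suc_right)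
    thus ?case by (simp only: \<delta>(2) Suc)
  qed simp
  have GF2_iff: "x \<in> GF2 i \<longleftrightarrow> \<delta> dvd i" for i
  proof
    assume "x \<in> GF2 i"
    hence "x ^ 2 ^ (\<delta> * (i div \<delta>) + i mod \<delta>) = x"
      unfolding mult_div_mod_eq by (simp add: GF2_def)
    hence "x ^ 2 ^ (i mod \<delta>) = x" by (simp only: frob_frob[symmetric] mult)
    hence "\<not> i mod \<delta> > 0" using min[of "i mod \<delta>"] \<delta>(1) by (meson mod_less_divisor not_le)
    thus "\<delta> dvd i" by (simp add: dvd_eq_mod_eq_0)
  qed (auto simp: GF2_def mult)
  have inj: "inj_on (\<lambda>j. x ^ 2 ^ j) {..<\<delta>}"
  proof (rule linorder_inj_onI)
    fix i j assume "i < j" "i \<in> {..<\<delta>}" "j \<in> {..<\<delta>}"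
    hence "j - i > 0" "\<not> \<delta> \<le> j - i" "i \<le> j" by auto
    thus "x ^ 2 ^ i \<noteq> x ^ 2 ^ j" using period[of i j] min[of "j - i"] by blast
  qed auto
  have count_\<delta>: "count (frob_orbit \<delta> x) y = (if y \<in> (\<lambda>j. x ^ 2 ^ j) ` {..<\<delta>} then 1 else 0)" for y
    unfolding frob_orbit_def image_mset_mset_set[OF inj] by simp
  have split: "frob_orbit (i + j) x = frob_orbit i x + frob_orbit j (x ^ 2 ^ i)" for i j
    by (induction j) (simp_all add: frob_orbit_Suc frob_frob)
  have orbit_mult: "frob_orbit (\<delta> * j) x = repeat_mset j (frob_orbit \<delta> x)" for j
    by (induction j) (simp_all add: split \<delta>(2))
  have sub_iff: "frob_orbit (\<delta> * j) x \<subseteq># M \<longleftrightarrow> j \<le> count M x" for j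
  proof
    assume "frob_orbit (\<delta> * j) x \<subseteq># M"
    hence "count (frob_orbit (\<delta> * j) x) x \<le> count M x" by (rule mset_subset_eq_count)
    moreover have "x \<in> (\<lambda>j. x ^ 2 ^ j) ` {..<\<delta>}" using \<delta>(1) by (intro image_eqI[of _ _ 0]) auto
    ultimately show "j \<le> count M x" by (simp add: orbit_mult count_\<delta>)
  next
    assume "j \<le> count M x"
    thus "frob_orbit (\<delta> * j) x \<subseteq># M"
      by (auto simp: subseteq_mset_def orbit_mult count_\<delta> count_frob[OF M])
  qed
  have "{i. i > 0 \<and> x \<in> GF2 i \<and> frob_orbit i x \<subseteq># M} = (\<lambda>j. \<delta> * j) ` {1..count M x}"
    using \<delta>(1) by (auto simp: GF2_iff sub_iff dvd_def)
  also have "card \<dots> = count M x"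
    using \<delta>(1) by (subst card_image) (auto simp: inj_on_def)
  finally show ?thesis .
qed

section \<open>Monic polynomials over the prime field and their root multisets\<close>

definition frob_poly :: "F2bar poly \<Rightarrow> F2bar poly" where
  "frob_poly p = map_poly (\<lambda>c. c ^ 2) p"

lemma coeff_frob_poly: "coeff (frob_poly p) n = coeff p n ^ 2"
  by (simp add: frob_poly_def coeff_map_poly)

lemma frob_poly_mult: "frob_poly (p * q) = frob_poly p * frob_poly q"
proof (rule poly_eqI)
  fix n
  have "(\<Sum>i\<le>n. coeff p i * coeff q (n - i)) ^ 2 = (\<Sum>i\<le>n. (coeff p i * coeff q (n - i)) ^ 2)"
    by (rule freshmans_dream_sum) (simp_all add: CHAR_F2bar)
  thus "coeff (frob_poly (p * q)) n = coeff (frob_poly p * frob_poly q) n"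
    by (simp add: coeff_frob_poly coeff_mult power_mult_distrib)
qed

definition root_poly :: "F2bar multiset \<Rightarrow> F2bar poly" where
  "root_poly M = (\<Prod>x\<in>#M. [:-x, 1:])"

lemma root_poly_simps [simp]:
  "root_poly {#} = 1" "root_poly (add_mset x M) = [:-x, 1:] * root_poly M"
  by (simp_all add: root_poly_def)

lemma minus_F2bar: "- (x :: F2bar) = x"
proof -
  have "x + x = 2 * x" by (rule mult_2[symmetric])
  thus ?thesis by (simp add: two_F2bar minus_unique)
qed

lemma frob_poly_root_poly: "frob_poly (root_poly M) = root_poly (image_mset (\<lambda>x. x ^ 2) M)"
proof (induction M)
  case empty
  show ?case by (simp add: poly_eq_iff coeff_frob_poly coeff_1)
next
  case (add x M)
  have "frob_poly [:-x, 1:] = [:-(x ^ 2), 1:]" 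
    by (rule poly_eqI) (auto simp: coeff_frob_poly coeff_pCons minus_F2bar split: nat.splits)
  thus ?case by (simp add: frob_poly_mult add del: mult_pCons_left)
qed

lemma root_poly_nonzero [simp]: "root_poly M \<noteq> 0"
  by (auto simp: root_poly_def)

lemma proots_root_poly [simp]: "proots (root_poly M) = M"
proof (induction M)
  case (add x M)
  have "proots ([:-x, 1:] * root_poly M) = proots [:-x, 1:] + proots (root_poly M)"
    by (rule proots_mult) auto
  thus ?case using add by (simp del: mult_pCons_left)
qed simp

lemma degree_root_poly [simp]: "Polynomial.degree (root_poly M) = size M"
proof (induction M)
  case (add x M)
  have "Polynomial.degree ([:-x, 1:] * root_poly M) = 1 + Polynomial.degree (root_poly M)"
    by (subst degree_mult_eq) auto
  thus ?case using add by (simp del: mult_pCons_left)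
qed simp

lemma lead_coeff_root_poly: "Polynomial.lead_coeff (root_poly M) = 1"
  by (induction M) (simp_all add: lead_coeff_mult del: mult_pCons_left degree_root_poly)

lemma root_poly_proots:
  fixes h :: "F2bar poly"
  assumes "Polynomial.lead_coeff h = 1"
  shows "root_poly (proots h) = h"
proof -
  have "h \<noteq> 0" using assms by auto
  then obtain A where "h = smult (Polynomial.lead_coeff h) (\<Prod>x\<in>#A. [:- x, 1:])"
    using alg_closed_imp_factorization by blast
  hence "h = root_poly A" by (simp add: assms root_poly_def)
  thus ?thesis by simp
qed

lemma coeff_0_root_poly: "coeff (root_poly M) 0 = 0 \<longleftrightarrow> 0 \<in># M"
  by (induction M) (auto simp: coeff_mult_0)

text \<open>A nonzero constant term over the prime field is 1, and so is the leading coefficient;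
  only the coefficients in between are free. A list of length \<open>d\<close> encodes degree
  \<open>d + 1\<close>.\<close>

definition bits_poly :: "bit list \<Rightarrow> F2bar poly" where
  "bits_poly bs = Poly (1 # map to_ac bs @ [1])"

lemma coeff_bits_poly:
  "coeff (bits_poly bs) i = (if i = 0 then 1 else if i \<le> length bs then to_ac (bs ! (i - 1))
     else if i = Suc (length bs) then 1 else 0)"
  unfolding bits_poly_def coeff_Poly_eq
  by (auto simp: nth_default_def nth_Cons nth_append split: nat.splits)

lemma degree_bits_poly: "Polynomial.degree (bits_poly bs) = Suc (length bs)"
  by (rule antisym[OF degree_le le_degree]) (auto simp: coeff_bits_poly)

text \<open>A monic polynomial has its coefficients in the prime field exactly if Frobenius permutes
  its roots with multiplicity.\<close>

lemma bij_betw_frob_msets: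
  "bij_betw (\<lambda>bs. proots (bits_poly bs)) {bs. length bs = d} (frob_msets (Suc d))"
proof (rule bij_betw_imageI)
  have lc: "Polynomial.lead_coeff (bits_poly bs) = 1" for bs
    by (simp add: degree_bits_poly coeff_bits_poly)
  have rp: "root_poly (proots (bits_poly bs)) = bits_poly bs" for bs
    using lc by (rule root_poly_proots)
  show "inj_on (\<lambda>bs. proots (bits_poly bs)) {bs. length bs = d}"
  proof (rule inj_onI)
    fix bs bs' :: "bit list"
    assume l: "bs \<in> {bs. length bs = d}" "bs' \<in> {bs. length bs = d}"
      and "proots (bits_poly bs) = proots (bits_poly bs')"
    hence eq: "bits_poly bs = bits_poly bs'" by (metis rp)
    show "bs = bs'"
    proof (rule nth_equalityI)
      fix i assume "i < length bs"
      thus "bs ! i = bs' ! i"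
        using arg_cong[OF eq, of "\<lambda>h. coeff h (Suc i)"] l by (simp add: coeff_bits_poly)
    qed (use l in simp)
  qed
  show "(\<lambda>bs. proots (bits_poly bs)) ` {bs. length bs = d} = frob_msets (Suc d)"
  proof (intro equalityI subsetI)
    fix M assume "M \<in> (\<lambda>bs. proots (bits_poly bs)) ` {bs. length bs = d}"
    then obtain bs where bs: "length bs = d" "M = proots (bits_poly bs)" by auto
    have "coeff (bits_poly bs) i ^ 2 = coeff (bits_poly bs) i" for i
      by (auto simp: coeff_bits_poly frob_fixed_iff)
    hence "frob_poly (root_poly M) = root_poly M"
      by (simp add: bs(2) rp poly_eq_iff coeff_frob_poly)
    hence "image_mset (\<lambda>x. x ^ 2) M = M"
      using proots_root_poly by (metis frob_poly_root_poly)
    moreover have "size M = Suc d"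
      using degree_root_poly[of M] by (simp add: bs rp degree_bits_poly)
    moreover have "0 \<notin># M"
      using coeff_0_root_poly[of M] by (simp add: bs rp coeff_bits_poly)
    ultimately show "M \<in> frob_msets (Suc d)" by (simp add: frob_msets_def)
  next
    fix M assume "M \<in> frob_msets (Suc d)"
    hence M: "size M = Suc d" "0 \<notin># M" "image_mset (\<lambda>x. x ^ 2) M = M"
      by (auto simp: frob_msets_def)
    define h where "h = root_poly M"
    have "frob_poly h = h" by (simp add: h_def frob_poly_root_poly M(3))
    hence "coeff h i ^ 2 = coeff h i" for i by (metis coeff_frob_poly)
    hence bit: "\<exists>b. coeff h i = to_ac b" for i using frob_fixed_iff by blast
    define bs where "bs = map (\<lambda>i. of_ac (coeff h (Suc i))) [0..<d]"
    have bs: "to_ac (bs ! i) = coeff h (Suc i)" if "i < d" for i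
      using bit[of "Suc i"] that by (auto simp: bs_def)
    have h0: "coeff h 0 = 1"
    proof -
      obtain b where b: "coeff h 0 = to_ac b" using bit by blast
      thus ?thesis using coeff_0_root_poly[of M] M(2) by (cases b) (auto simp: h_def)
    qed
    have hd: "coeff h (Suc d) = 1" using lead_coeff_root_poly[of M] by (simp add: h_def M(1))
    have "h = bits_poly bs"
    proof (rule poly_eqI)
      fix i
      consider "i = 0" | j where "i = Suc j" "j < d" | "i = Suc d" | "i > Suc d"
        by (cases i) (auto simp: not_less_iff_gr_or_eq[symmetric] less_Suc_eq, linarith)
      thus "coeff h i = coeff (bits_poly bs) i"
      proof cases
        case 4
        hence "coeff h i = 0" by (intro coeff_eq_0) (simp add: h_def M(1))
        thus ?thesis using 4 by (simp add: coeff_bits_poly bs_def)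
      qed (use h0 hd bs in \<open>auto simp: coeff_bits_poly, auto simp: bs_def\<close>)
    qed
    hence "M = proots (bits_poly bs)" by (simp flip: \<open>h = bits_poly bs\<close> add: h_def)
    thus "M \<in> (\<lambda>bs. proots (bits_poly bs)) ` {bs. length bs = d}"
      by (auto simp: bs_def)
  qed
qed

lemma finite_frob_msets: "finite (frob_msets d)"
proof (cases d)
  case 0
  have "frob_msets 0 = {{#}}" by (auto simp: frob_msets_def)
  thus ?thesis using 0 by simp
next
  case (Suc d')
  have "(UNIV :: bit set) = {0, 1}" by (auto intro: bit.exhaust)
  hence "finite (UNIV :: bit set)" by (metis finite.emptyI finite_insert)
  hence "finite {bs :: bit list. length bs = d'}"
    using finite_lists_length_eq[of "UNIV :: bit set" d'] by simp
  thus ?thesis unfolding Suc using bij_betw_finite[OF bij_betw_frob_msets] by simp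
qed

text \<open>Vieta's formula for the two lowest coefficients, free of signs because minus is the
  identity in characteristic 2.\<close>

lemma sum_inverse_roots:
  assumes "0 \<notin># M"
  shows "coeff (root_poly M) 1 = coeff (root_poly M) 0 * (\<Sum>x\<in>#M. inverse x)"
  using assms
proof (induction M)
  case (add x M)
  have *: "coeff ([:-x, 1:] * root_poly M) 1 = x * coeff (root_poly M) 1 + coeff (root_poly M) 0"
    by (simp add: minus_F2bar coeff_pCons)
  have **: "coeff ([:-x, 1:] * root_poly M) 0 = x * coeff (root_poly M) 0"
    by (simp add: minus_F2bar)
  have x: "x * inverse x = 1" using add.prems by auto
  have "0 \<notin># M" using add.prems by auto
  from add.IH[OF this] have "x * coeff (root_poly M) 1 + coeff (root_poly M) 0 =
      x * coeff (root_poly M) 0 * (\<Sum>x\<in>#M. inverse x) + coeff (root_poly M) 0 * (x * inverse x)"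
    by (simp only: x mult.assoc mult_1_right)
  thus ?case
    unfolding root_poly_simps * ** by (simp add: algebra_simps)
qed (simp add: coeff_1)

text \<open>The reversed polynomial is \<open>\<Prod>(1 - x X)\<close>, whose logarithmic derivative is the negative of the
  generating function of the power sums; this is Newton's identity.\<close>

lemma reflect_root_poly_log_deriv:
  assumes "0 \<notin># M"
  shows "has_log_deriv (fps_of_poly (reflect_poly (root_poly M)))
    (- Abs_fps (\<lambda>i. if i = 0 then 0 else \<Sum>x\<in>#M. x ^ i))"
  using assms
proof (induction M)
  case empty
  have 0: "- Abs_fps (\<lambda>i. if i = 0 then 0 else \<Sum>x\<in>#{#}. x ^ i :: F2bar) = 0"
    by (simp add: fps_eq_iff)
  show ?case unfolding 0 by (simp add: has_log_deriv_1)
next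
  case (add x M)
  hence x: "x \<noteq> 0" by auto
  define P where "P = (\<lambda>M. Abs_fps (\<lambda>i. if i = 0 then 0 else \<Sum>x\<in>#M. x ^ i :: F2bar))"
  have lin: "fps_of_poly [:1, -x:] = 1 - fps_const x * fps_X"
    by (simp add: fps_eq_iff coeff_pCons split: nat.splits)
  have "has_log_deriv (fps_of_poly [:1, -x:]) (- P {#x#})"
    using has_log_deriv_linear[of x] unfolding lin P_def by (simp only: image_mset_single sum_mset.singleton)
  moreover have "has_log_deriv (fps_of_poly (reflect_poly (root_poly M))) (- P M)"
    using add by (simp add: P_def)
  ultimately have "has_log_deriv (fps_of_poly [:1, -x:] * fps_of_poly (reflect_poly (root_poly M)))
      (- P {#x#} + - P M)" by (rule has_log_deriv_mult)
  moreover have "reflect_poly (root_poly (add_mset x M)) = [:1, -x:] * reflect_poly (root_poly M)"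
    using x by (simp add: reflect_poly_mult reflect_poly_pCons del: mult_pCons_left)
  moreover have "- P {#x#} + - P M = - P (add_mset x M)"
    by (simp add: P_def fps_eq_iff)
  ultimately show ?case by (simp only: fps_of_poly_mult P_def)
qed

text \<open>Newton's identity, read off from the recursion for the logarithmic derivative. The term
  of index 0 is the power sum itself, and in characteristic 2 no signs appear.\<close>

lemma power_sum_rec:
  assumes "0 \<notin># M" "n > 0"
  shows "(\<Sum>x\<in>#M. x ^ n) = of_nat n * coeff (reflect_poly (root_poly M)) n +
    (\<Sum>i=1..<n. coeff (reflect_poly (root_poly M)) i * (\<Sum>x\<in>#M. x ^ (n - i)))"
proof -
  define g where "g = reflect_poly (root_poly M)"
  have g0: "coeff g 0 = 1" by (simp add: g_def lead_coeff_root_poly del: degree_root_poly)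
  have ld: "of_nat n * fps_of_poly g $ n = (\<Sum>i<n. fps_of_poly g $ i *
      (- Abs_fps (\<lambda>i. if i = 0 then 0 else \<Sum>x\<in>#M. x ^ i)) $ (n - i))"
    unfolding g_def by (rule has_log_deriv_rec[OF reflect_root_poly_log_deriv[OF assms(1)]])
       (simp add: lead_coeff_root_poly del: degree_root_poly)
  also have "\<dots> = (\<Sum>i=0..<n. coeff g i * (\<Sum>x\<in>#M. x ^ (n - i)))"
    by (rule sum.cong) (auto simp: minus_F2bar)
  also have "\<dots> = (\<Sum>x\<in>#M. x ^ n) + (\<Sum>i=1..<n. coeff g i * (\<Sum>x\<in>#M. x ^ (n - i)))"
    using assms(2) by (simp add: sum.atLeast_Suc_lessThan g0)
  finally have "(\<Sum>x\<in>#M. x ^ n) =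
      of_nat n * coeff g n - (\<Sum>i=1..<n. coeff g i * (\<Sum>x\<in>#M. x ^ (n - i)))"
    by (simp add: algebra_simps)
  thus ?thesis by (simp only: diff_conv_add_uminus minus_F2bar g_def)
qed

text \<open>By Newton's recursion the power sum of exponent \<open>n\<close> depends only on the top
  \<open>n + 1\<close> coefficients.\<close>

lemma power_sum_cong:
  assumes "0 \<notin># M" "0 \<notin># N"
    and "\<And>i. i \<le> n \<Longrightarrow> coeff (reflect_poly (root_poly M)) i = coeff (reflect_poly (root_poly N)) i"
    and "n > 0"
  shows "(\<Sum>x\<in>#M. x ^ n) = (\<Sum>x\<in>#N. x ^ n)"
  using assms(3,4)
proof (induction n rule: less_induct)
  case (less n)
  have "(\<Sum>x\<in>#M. x ^ (n - i)) = (\<Sum>x\<in>#N. x ^ (n - i))" if "i \<in> {1..<n}" for i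
    using that less by (intro less.IH) auto
  thus ?case
    using less.prems by (simp add: power_sum_rec[OF assms(1)] power_sum_rec[OF assms(2)])
qed

section \<open>The L-polynomial\<close>

text \<open>The coefficient of \<open>t^d\<close> in the L-series of the character on monic
  polynomials with nonzero constant term.\<close>

definition L_coeff :: "nat \<Rightarrow> nat \<Rightarrow> int" where
  "L_coeff k d = (\<Sum>M\<in>frob_msets d. sign_char (mset_val k M))"

lemma finite_GF2: "i > 0 \<Longrightarrow> finite (GF2 i)"
  using card_GF2[of i] by (intro card_ge_0_finite) simp

lemma frob_msets_0: "frob_msets 0 = {{#}}"
  by (auto simp: frob_msets_def)

lemma L_coeff_0: "L_coeff k 0 = 1"
  by (simp add: L_coeff_def frob_msets_0 mset_val_def sign_char_def)

text \<open>Removing the orbit is a bijection onto the stable multisets of size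
  \<open>n - i\<close>, and the character is multiplicative.\<close>

lemma sum_frob_msets_containing:
  assumes "x \<in> GF2 i" "x \<noteq> 0" "i \<le> n"
  shows "(\<Sum>M | M \<in> frob_msets n \<and> frob_orbit i x \<subseteq># M. sign_char (mset_val k M)) =
    sign_char (Tr i (curve_fun k x)) * L_coeff k (n - i)"
proof -
  define A where "A = frob_orbit i x"
  have A: "image_mset (\<lambda>x. x ^ 2) A = A" "0 \<notin># A" "size A = i"
    using assms frob_orbit_stable zero_notin_frob_orbit by (auto simp: A_def)
  have "(\<Sum>M | M \<in> frob_msets n \<and> A \<subseteq># M. sign_char (mset_val k M)) =
      (\<Sum>M\<in>frob_msets (n - i). sign_char (mset_val k (A + M)))"
  proof (rule sum.reindex_bij_witness[of _ "\<lambda>M. A + M" "\<lambda>M. M - A"])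
    fix M assume M: "M \<in> {M. M \<in> frob_msets n \<and> A \<subseteq># M}"
    then obtain N where N: "M = A + N" by (auto simp: subset_mset.le_iff_add)
    show "A + (M - A) = M" by (simp add: N)
    show "M - A \<in> frob_msets (n - i)"
      using M A by (auto simp: N frob_msets_def)
    show "sign_char (mset_val k (A + (M - A))) = sign_char (mset_val k M)" by (simp add: N)
  next
    fix M assume "M \<in> frob_msets (n - i)"
    thus "A + M \<in> {M. M \<in> frob_msets n \<and> A \<subseteq># M}"
      using A assms(3) by (auto simp: frob_msets_def)
  qed simp
  also have "\<dots> = (\<Sum>M\<in>frob_msets (n - i). sign_char (mset_val k A) * sign_char (mset_val k M))"
  proof (intro sum.cong refl)
    fix M assume "M \<in> frob_msets (n - i)"
    hence "image_mset (\<lambda>x. x ^ 2) M = M" by (simp add: frob_msets_def)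
    thus "sign_char (mset_val k (A + M)) = sign_char (mset_val k A) * sign_char (mset_val k M)"
      by (simp only: mset_val_union[OF A(1)] sign_char_add)
  qed
  finally show ?thesis
    by (simp add: A_def mset_val_frob_orbit L_coeff_def sum_distrib_left)
qed

text \<open>Each element of \<open>M\<close> contributes its multiplicity, by
  \<open>card_frob_orbits_within\<close>, and the multiplicities add up to the size.\<close>

lemma card_frob_orbits:
  assumes "M \<in> frob_msets n"
  shows "card {(i, x). i \<in> {1..n} \<and> x \<in> GF2 i - {0} \<and> frob_orbit i x \<subseteq># M} = n"
proof -
  have M: "size M = n" "0 \<notin># M" "image_mset (\<lambda>x. x ^ 2) M = M"
    using assms by (auto simp: frob_msets_def)
  define I where "I = (\<lambda>x. {i. i > 0 \<and> x \<in> GF2 i \<and> frob_orbit i x \<subseteq># M})"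
  have le: "i \<le> n" if "frob_orbit i x \<subseteq># M" for i x
    using size_mset_mono[OF that] by (simp add: M(1))
  have mem: "x \<in># M" if "frob_orbit i x \<subseteq># M" "i > 0" for i x
  proof -
    have "x \<in># frob_orbit i x" using that(2) by (auto simp: frob_orbit_def intro!: image_eqI[of _ _ 0])
    thus ?thesis using that(1) by (rule mset_subset_eqD[rotated])
  qed
  have fin: "finite (I x)" for x
    by (rule finite_subset[of _ "{..n}"]) (auto simp: I_def le)
  have "{(i, x). i \<in> {1..n} \<and> x \<in> GF2 i - {0} \<and> frob_orbit i x \<subseteq># M} =
      (\<lambda>(x, i). (i, x)) ` (SIGMA x:set_mset M. I x)"
  proof (intro equalityI subsetI)
    fix t assume "t \<in> {(i, x). i \<in> {1..n} \<and> x \<in> GF2 i - {0} \<and> frob_orbit i x \<subseteq># M}"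
    then obtain i x where t: "t = (i, x)" "i > 0" "x \<in> GF2 i" "frob_orbit i x \<subseteq># M" by auto
    thus "t \<in> (\<lambda>(x, i). (i, x)) ` (SIGMA x:set_mset M. I x)"
      using mem[OF t(4,2)] by (auto simp: I_def)
  qed (use M(2) le in \<open>auto simp: I_def Suc_le_eq\<close>)
  also have "card \<dots> = card (SIGMA x:set_mset M. I x)"
    by (rule card_image) (auto simp: inj_on_def)
  also have "\<dots> = (\<Sum>x\<in>set_mset M. card (I x))"
    using fin by (intro card_SigmaI) auto
  also have "\<dots> = (\<Sum>x\<in>set_mset M. count M x)"
    using card_frob_orbits_within[OF M(3)] by (intro sum.cong) (auto simp: I_def)
  finally show ?thesis by (simp add: M(1) flip: size_multiset_overloaded_eq)
qed

lemma G_eq: "G n k = (\<Sum>x\<in>GF2 n - {0}. sign_char (Tr n (curve_fun k x)))"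
  by (simp add: G_def curve_fun_def)

text \<open>The Euler product in logarithmic form, by counting pairs of a stable multiset and an orbit
  inside it.\<close>

lemma L_coeff_rec: "int n * L_coeff k n = (\<Sum>i=1..n. G i k * L_coeff k (n - i))"
proof -
  define S where "S = (SIGMA i:{1..n}. GF2 i - {0})"
  have fin: "finite S" unfolding S_def using finite_GF2 by (intro finite_SigmaI) auto
  have "int n * L_coeff k n = (\<Sum>M\<in>frob_msets n. sign_char (mset_val k M) *
      int (card {(i, x). i \<in> {1..n} \<and> x \<in> GF2 i - {0} \<and> frob_orbit i x \<subseteq># M}))"
    unfolding L_coeff_def sum_distrib_left
    by (intro sum.cong) (simp_all only: card_frob_orbits mult.commute)
  also have "\<dots> = (\<Sum>M\<in>frob_msets n. \<Sum>s\<in>S.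
      if frob_orbit (fst s) (snd s) \<subseteq># M then sign_char (mset_val k M) else 0)"
  proof (intro sum.cong refl)
    fix M
    have "{(i, x). i \<in> {1..n} \<and> x \<in> GF2 i - {0} \<and> frob_orbit i x \<subseteq># M} =
        {s \<in> S. frob_orbit (fst s) (snd s) \<subseteq># M}"
      by (auto simp: S_def)
    thus "sign_char (mset_val k M) *
        int (card {(i, x). i \<in> {1..n} \<and> x \<in> GF2 i - {0} \<and> frob_orbit i x \<subseteq># M}) =
      (\<Sum>s\<in>S. if frob_orbit (fst s) (snd s) \<subseteq># M then sign_char (mset_val k M) else 0)"
      using fin by (simp add: mult.commute flip: sum.inter_filter)
  qed
  \<comment> \<open>Exchanging the summations fixes the orbit first and lets the multisets
    containing it vary.\<close>
  also have "\<dots> = (\<Sum>s\<in>S. \<Sum>M | M \<in> frob_msets n \<and> frob_orbit (fst s) (snd s) \<subseteq># M.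
      sign_char (mset_val k M))"
    by (subst sum.swap) (simp add: sum.inter_filter finite_frob_msets)
  also have "\<dots> = (\<Sum>(i, x)\<in>S. sign_char (Tr i (curve_fun k x)) * L_coeff k (n - i))"
  proof (intro sum.cong refl)
    fix s assume "s \<in> S"
    then obtain i x where s': "i \<in> {1..n}" "x \<in> GF2 i - {0}" "s = (i, x)"
      unfolding S_def by (rule SigmaE)
    hence s: "s = (i, x)" "x \<in> GF2 i" "x \<noteq> 0" "i \<le> n" by simp_all
    show "(\<Sum>M | M \<in> frob_msets n \<and> frob_orbit (fst s) (snd s) \<subseteq># M. sign_char (mset_val k M)) =
        (case s of (i, x) \<Rightarrow> sign_char (Tr i (curve_fun k x)) * L_coeff k (n - i))"
      using sum_frob_msets_containing[OF s(2-4)] by (simp add: s(1))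
  qed
  also have "\<dots> = (\<Sum>i=1..n. G i k * L_coeff k (n - i))"
    unfolding S_def using finite_GF2
    by (subst sum.Sigma[symmetric]) (auto simp: G_eq sum_distrib_right)
  finally show ?thesis .
qed

section \<open>The coefficients as sums over bit lists\<close>

lemma to_ac_mset_val_bits:
  "to_ac (mset_val k (proots (bits_poly bs))) =
    (\<Sum>x\<in>#proots (bits_poly bs). x ^ (2 ^ k + 1)) + coeff (bits_poly bs) 1"
  and zero_notin_proots_bits: "0 \<notin># proots (bits_poly bs)"
  and root_poly_proots_bits: "root_poly (proots (bits_poly bs)) = bits_poly bs"
proof -
  define M where "M = proots (bits_poly bs)"
  have "M \<in> frob_msets (Suc (length bs))"
    using bij_betw_apply[OF bij_betw_frob_msets, of bs "length bs"] by (simp add: M_def)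
  hence M: "image_mset (\<lambda>x. x ^ 2) M = M" "0 \<notin># M" by (auto simp: frob_msets_def)
  show rp: "root_poly (proots (bits_poly bs)) = bits_poly bs"
    by (rule root_poly_proots) (simp add: degree_bits_poly coeff_bits_poly)
  have "(\<Sum>x\<in>#M. inverse x) = coeff (bits_poly bs) 1"
    using sum_inverse_roots[OF M(2)] unfolding M_def rp by (simp add: coeff_bits_poly)
  thus "to_ac (mset_val k (proots (bits_poly bs))) =
      (\<Sum>x\<in>#proots (bits_poly bs). x ^ (2 ^ k + 1)) + coeff (bits_poly bs) 1"
    using to_ac_mset_val[OF M(1), of k]
    by (simp add: M_def curve_fun_def sum_mset.distrib)
  show "0 \<notin># proots (bits_poly bs)" using M(2) by (simp add: M_def)
qed

lemma L_coeff_Suc: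
  "L_coeff k (Suc d) = (\<Sum>bs | length bs = d. sign_char (mset_val k (proots (bits_poly bs))))"
  unfolding L_coeff_def by (rule sum.reindex_bij_betw[OF bij_betw_frob_msets, symmetric])

lemma finite_bit_lists: "finite {bs :: bit list. length bs = d}"
  using bij_betw_finite[OF bij_betw_frob_msets] finite_frob_msets by blast

lemma sum_bit_lists_Suc:
  "(\<Sum>bs | length bs = Suc d. f bs) = (\<Sum>bs :: bit list | length bs = d. f (0 # bs) + f (1 # bs))"
proof -
  have "{bs :: bit list. length bs = Suc d} =
      (#) 0 ` {bs. length bs = d} \<union> (#) 1 ` {bs. length bs = d}"
  proof (intro equalityI subsetI)
    fix bs :: "bit list" assume "bs \<in> {bs. length bs = Suc d}"
    then obtain b cs where "bs = b # cs" "length cs = d" by (auto simp: length_Suc_conv)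
    thus "bs \<in> (#) 0 ` {bs. length bs = d} \<union> (#) 1 ` {bs. length bs = d}"
      by (cases b) auto
  qed auto
  moreover have "(#) (0 :: bit) ` {bs. length bs = d} \<inter> (#) 1 ` {bs. length bs = d} = {}" by auto
  ultimately show ?thesis
    by (simp add: sum.union_disjoint finite_bit_lists sum.reindex sum.distrib)
qed

text \<open>For large \<open>d\<close> the coefficient of \<open>X\<close> does not enter the power sum of the roots, but it is the
  sum of their inverses, so flipping it flips the sign.\<close>

lemma L_coeff_eq_0:
  assumes "d \<ge> 2 ^ k + 3"
  shows "L_coeff k d = 0"
proof -
  \<comment> \<open>The polynomials of degree \<open>d\<close> are given by lists of length
    \<open>e + 1\<close>; the head is the coefficient of \<open>X\<close>, and the tail has length
    \<open>e\<close>.\<close>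
  define e where "e = d - 2"
  have e: "d = Suc (Suc e)" "e \<ge> 2 ^ k + 1" using assms by (auto simp: e_def)
  have "sign_char (mset_val k (proots (bits_poly (0 # bs)))) +
      sign_char (mset_val k (proots (bits_poly (1 # bs)))) = 0" if bs: "length bs = e" for bs
  proof -
    \<comment> \<open>In the reversed polynomial the coefficient of \<open>X\<close> has index
      \<open>e + 1\<close>, beyond the indices up to \<open>2 ^ k + 1\<close> that enter the power
      sum.\<close>
    have "coeff (reflect_poly (bits_poly (b # bs))) i = coeff (reflect_poly (bits_poly (c # bs))) i"
      if "i \<le> 2 ^ k + 1" for b c i
    proof -
      have "Suc (Suc e) - i = Suc (Suc (e - i))" using that e(2) by linarith
      thus ?thesis
        by (simp add: coeff_reflect_poly degree_bits_poly coeff_bits_poly bs)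
    qed
    hence "(\<Sum>x\<in>#proots (bits_poly (0 # bs)). x ^ (2 ^ k + 1)) =
        (\<Sum>x\<in>#proots (bits_poly (1 # bs)). x ^ (2 ^ k + 1))"
      by (intro power_sum_cong zero_notin_proots_bits) (auto simp: root_poly_proots_bits)
    hence "to_ac (mset_val k (proots (bits_poly (1 # bs)))) =
        to_ac (mset_val k (proots (bits_poly (0 # bs))) + 1)"
      unfolding to_ac_mset_val_bits to_ac_add by (simp add: coeff_bits_poly del: power_Suc)
    thus ?thesis unfolding to_ac_eq_iff by (simp add: sign_char_add) (simp add: sign_char_def)
  qed
  thus ?thesis by (simp add: e(1) L_coeff_Suc sum_bit_lists_Suc)
qed

text \<open>The largest possible degree is \<open>2 ^ k + 2\<close>, which for positive
  \<open>k\<close> is twice the genus.\<close>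

definition L_poly :: "nat \<Rightarrow> int poly" where
  "L_poly k = Poly (map (L_coeff k) [0..<2 ^ k + 3])"

lemma coeff_L_poly: "coeff (L_poly k) d = L_coeff k d"
  using L_coeff_eq_0[of k d]
  by (auto simp: L_poly_def nth_default_def not_less simp del: upt_Suc)

text \<open>Here \<open>g i\<close> is the coefficient \<open>i\<close> places below the top.
  Newton's recursion expresses the sum of cubes through \<open>g 1\<close>, \<open>g 2\<close> and
  \<open>g 3\<close>, and a bit equals its cube. Appending 1 covers the empty list, for which the
  coefficient of \<open>X\<close> is the leading one.\<close>

lemma mset_val_1_bits:
  fixes bs :: "bit list"
  defines "g \<equiv> nth_default 0 (rev (1 # bs @ [1]))"
  shows "mset_val 1 (proots (bits_poly bs)) = g 3 + g 1 * g 2 + g 1 + (bs @ [1]) ! 0"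
proof -
  define M where "M = proots (bits_poly bs)"
  define c where "c = coeff (reflect_poly (root_poly M))"
  have coeffs: "coeffs (bits_poly bs) = map to_ac (1 # bs @ [1])"
    by (simp add: bits_poly_def del: Poly.simps)
  have c: "c i = to_ac (g i)" for i
    unfolding c_def M_def root_poly_proots_bits reflect_poly_def g_def coeff_Poly_eq
      coeffs rev_map
    by (rule nth_default_map_eq) simp
  define p where "p = (\<lambda>n. \<Sum>x\<in>#M. x ^ n)"
  have rec: "p n = of_nat n * c n + (\<Sum>i=1..<n. c i * p (n - i))" if "n > 0" for n
    unfolding p_def c_def by (rule power_sum_rec[OF _ that]) (simp add: M_def zero_notin_proots_bits)
  have ivl: "{1..<2::nat} = {1}" "{1..<3::nat} = {1, 2}" by auto
  have "p 1 = c 1" using rec[of 1] by simp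
  moreover have "p 2 = c 1 * p 1" using rec[of 2] unfolding ivl by (simp add: two_F2bar)
  moreover have "p 3 = of_nat 3 * c 3 + c 1 * p 2 + c 2 * p 1"
    using rec[of 3] unfolding ivl by (simp add: algebra_simps)
  moreover have "of_nat 3 = (1 :: F2bar)" using two_F2bar by (simp add: numeral_3_eq_3 numeral_2_eq_2)
  ultimately have "p 3 = to_ac (g 3 + g 1 * (g 1 * g 1) + g 2 * g 1)"
    unfolding to_ac_add to_ac_mult c[symmetric] by simp
  moreover have "g 1 * (g 1 * g 1) = g 1" by (cases "g 1") auto
  moreover have "coeff (bits_poly bs) 1 = to_ac ((bs @ [1]) ! 0)"
    by (cases bs) (auto simp: coeff_bits_poly)
  ultimately have "to_ac (mset_val 1 M) =
      to_ac (g 3 + g 1 + g 2 * g 1 + (bs @ [1]) ! 0)"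
    using to_ac_mset_val_bits[of 1 bs] unfolding to_ac_add p_def M_def by simp
  thus ?thesis unfolding to_ac_eq_iff M_def by (simp only: ac_simps)
qed

text \<open>Direct evaluation over the bit lists of length at most 3; from degree 5 on
  \<open>L_coeff_eq_0\<close> applies.\<close>

lemma L_poly_1: "L_poly 1 = [:1, 1, 0, 2, 4:]"
proof -
  have "L_coeff 1 1 = 1" "L_coeff 1 2 = 0" "L_coeff 1 3 = 2" "L_coeff 1 4 = 4"
    by (simp_all add: numeral_eq_Suc L_coeff_Suc sum_bit_lists_Suc mset_val_1_bits[unfolded numeral_eq_Suc One_nat_def]
          nth_default_def sign_char_def)
  hence "coeff (L_poly 1) i = coeff [:1, 1, 0, 2, 4:] i" for i
    using L_coeff_0[of 1] L_coeff_eq_0[of 1 i]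
    by (auto simp: coeff_L_poly coeff_pCons numeral_eq_Suc split: nat.splits)
  thus ?thesis by (simp add: poly_eq_iff)
qed

lemma L_poly_log_deriv:
  "has_log_deriv (fps_of_poly (map_poly of_int (L_poly k)))
    (Abs_fps (\<lambda>n. if n = 0 then 0 else of_int (G n k) :: 'a :: field_char_0))"
proof (rule has_log_derivI)
  fix n
  have "of_int (int n * L_coeff k n) = (of_int (\<Sum>i=1..n. G i k * L_coeff k (n - i)) :: 'a)"
    by (simp only: L_coeff_rec)
  also have "\<dots> = (\<Sum>i=1..n. of_int (G i k) * of_int (L_coeff k (n - i)))" by simp
  also have "\<dots> = (\<Sum>i=0..<n. of_int (L_coeff k i) * of_int (G (n - i) k))"
    by (rule sum.reindex_bij_witness[of _ "\<lambda>i. n - i" "\<lambda>i. n - i"]) auto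
  finally show "of_nat n * fps_of_poly (map_poly of_int (L_poly k)) $ n =
    (\<Sum>i=0..n. fps_of_poly (map_poly of_int (L_poly k)) $ i *
      Abs_fps (\<lambda>n. if n = 0 then 0 else of_int (G n k) :: 'a) $ (n - i))"
    by (simp add: coeff_map_poly coeff_L_poly flip: atLeastLessThanSuc_atLeastAtMost)
qed

section \<open>Counting points by Artin-Schreier fibres\<close>

lemma artin_schreier_eq_iff:
  "(y :: F2bar) ^ 2 + y = z ^ 2 + z \<longleftrightarrow> y = z \<or> y = z + 1"
proof -
  have "y ^ 2 + y = z ^ 2 + z \<longleftrightarrow> (y - z) * (y - (z + 1)) + (y - z) * (2 * (z + 1)) = 0"
    by (simp add: algebra_simps power2_eq_square)
  also have "\<dots> \<longleftrightarrow> y = z \<or> y = z + 1" by (simp add: two_F2bar)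
  finally show ?thesis .
qed

text \<open>Additive Hilbert 90, by counting: the image of \<open>y \<mapsto> y^2 + y\<close> has \<open>2^(n-1)\<close> elements, the
  kernel of the trace at most as many.\<close>

lemma artin_schreier_image:
  assumes "n > 0"
  shows "(\<lambda>y. y ^ 2 + y) ` GF2 n = {c \<in> GF2 n. Tr n c = 0}"
proof (rule card_seteq)
  define tr where "tr = (\<lambda>x::F2bar. \<Sum>i<n. x ^ 2 ^ i)"
  define T :: "F2bar poly" where "T = (\<Sum>i<n. Polynomial.monom 1 (2 ^ i))"
  have Tr: "Tr n c = 0 \<longleftrightarrow> tr c = 0" if "c \<in> GF2 n" for c
    using to_ac_Tr[OF that] unfolding tr_def by (metis to_ac_eq_0_iff)
  show fin: "finite {c \<in> GF2 n. Tr n c = 0}" using finite_GF2[OF assms] by simp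
  show "(\<lambda>y. y ^ 2 + y) ` GF2 n \<subseteq> {c \<in> GF2 n. Tr n c = 0}"
  proof safe
    fix y assume y: "y \<in> GF2 n"
    show c: "y ^ 2 + y \<in> GF2 n" using y by (intro GF2_add GF2_power)
    have "(y ^ 2) ^ 2 ^ i = y ^ 2 ^ Suc i" for i using frob_frob[of y 1 i] by simp
    hence "tr (y ^ 2 + y) = (\<Sum>i<n. y ^ 2 ^ Suc i) + (\<Sum>i<n. y ^ 2 ^ i)"
      by (simp only: tr_def frob_add sum.distrib)
    \<comment> \<open>In characteristic 2 the sum may be read as a difference, which
      telescopes.\<close>
    also have "\<dots> = (\<Sum>i<n. y ^ 2 ^ Suc i - y ^ 2 ^ i)"
      by (simp only: sum.distrib diff_conv_add_uminus minus_F2bar)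
    also have "\<dots> = y ^ 2 ^ n - y ^ 2 ^ 0" by (rule sum_lessThan_telescope)
    also have "\<dots> = 0" using y by (simp add: GF2_def)
    finally show "Tr n (y ^ 2 + y) = 0" using Tr[OF c] by simp
  qed
  \<comment> \<open>The field is the disjoint union of the fibres over the image, each with at most
    two elements, so the image has at least half the size of the field.\<close>
  have "card (GF2 n) = card (\<Union>c\<in>(\<lambda>y. y ^ 2 + y) ` GF2 n. {y \<in> GF2 n. y ^ 2 + y = c})"
    by (rule arg_cong[where f = card]) auto
  also have "\<dots> = (\<Sum>c\<in>(\<lambda>y. y ^ 2 + y) ` GF2 n. card {y \<in> GF2 n. y ^ 2 + y = c})"
    using finite_GF2[OF assms] by (intro card_UN_disjoint) auto
  also have "\<dots> \<le> (\<Sum>c\<in>(\<lambda>y. y ^ 2 + y) ` GF2 n. 2)"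
  proof (intro sum_mono)
    fix c assume "c \<in> (\<lambda>y. y ^ 2 + y) ` GF2 n"
    then obtain z where z: "c = z ^ 2 + z" by blast
    have "card {y \<in> GF2 n. y ^ 2 + y = c} \<le> card {z, z + 1}"
      unfolding z artin_schreier_eq_iff by (intro card_mono) auto
    also have "\<dots> = 2" by simp
    finally show "card {y \<in> GF2 n. y ^ 2 + y = c} \<le> 2" .
  qed
  finally have le: "2 ^ n \<le> 2 * card ((\<lambda>y. y ^ 2 + y) ` GF2 n)"
    using card_GF2[OF assms] by simp
  \<comment> \<open>The linear coefficient shows that the trace polynomial is nonzero, so its degree
    bounds the number of its roots.\<close>
  have "coeff T 1 = (\<Sum>i<n. if i = 0 then 1 else 0)"
    unfolding T_def coeff_sum by (intro sum.cong) auto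
  hence "coeff T 1 = 1" using assms by simp
  hence T0: "T \<noteq> 0" by auto
  have "Polynomial.degree T \<le> 2 ^ (n - 1)" unfolding T_def
    by (intro degree_sum_le) (auto simp: Polynomial.degree_monom_eq)
  have "card {c \<in> GF2 n. Tr n c = 0} \<le> card {x. poly T x = 0}"
    using Tr poly_roots_finite[OF T0]
    by (intro card_mono) (auto simp: T_def tr_def poly_sum poly_monom)
  also have "\<dots> \<le> Polynomial.degree T" using T0 by (rule card_poly_roots_bound)
  also have "\<dots> \<le> 2 ^ (n - 1)" by fact
  also have "\<dots> \<le> card ((\<lambda>y. y ^ 2 + y) ` GF2 n)"
    using le assms by (cases n) auto
  finally show "card {c \<in> GF2 n. Tr n c = 0} \<le> card ((\<lambda>y. y ^ 2 + y) ` GF2 n)" .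
qed

lemma card_artin_schreier_fibre:
  assumes "n > 0" "c \<in> GF2 n"
  shows "int (card {y \<in> GF2 n. y ^ 2 + y = c}) = 1 + sign_char (Tr n c)"
proof (cases "Tr n c = 0")
  case True
  then obtain z where z: "z \<in> GF2 n" "c = z ^ 2 + z"
    using artin_schreier_image[OF assms(1)] assms(2) by blast
  have "{y \<in> GF2 n. y ^ 2 + y = c} = {z, z + 1}"
    unfolding z(2) artin_schreier_eq_iff using z(1) by (auto intro: GF2_add GF2_1)
  thus ?thesis using True by (simp add: sign_char_def)
next
  case False
  hence "{y \<in> GF2 n. y ^ 2 + y = c} = {}"
    using artin_schreier_image[OF assms(1)] by blast
  thus ?thesis unfolding sign_char_def using False by (simp only: card.empty) simp
qed

text \<open>Over each nonzero \<open>x\<close> lie as many points as 1 plus the sign of the trace;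
  the points over 0 and infinity complete the count.\<close>

lemma card_D_points_G:
  assumes "k > 0" "n > 0"
  shows "int (card (D_points k n)) = 2 ^ n + 1 + G n k"
proof -
  have fin: "finite (GF2 n)" using assms(2) by (rule finite_GF2)
  have "{(x, y). x \<in> GF2 n - {0} \<and> y \<in> GF2 n \<and> y ^ 2 + y = x ^ (2 ^ k + 1) + inverse x} =
      (SIGMA x:GF2 n - {0}. {y \<in> GF2 n. y ^ 2 + y = curve_fun k x})"
    by (auto simp: curve_fun_def)
  hence "int (card (D_points k n)) =
      (\<Sum>x\<in>GF2 n - {0}. int (card {y \<in> GF2 n. y ^ 2 + y = curve_fun k x})) + 2"
    using fin by (simp add: card_D_points[OF assms])
  also have "(\<Sum>x\<in>GF2 n - {0}. int (card {y \<in> GF2 n. y ^ 2 + y = curve_fun k x})) =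
      (\<Sum>x\<in>GF2 n - {0}. 1 + sign_char (Tr n (curve_fun k x)))"
    using assms(2) unfolding curve_fun_def
    by (intro sum.cong card_artin_schreier_fibre GF2_add GF2_power GF2_inverse) auto
  also have "\<dots> = int (card (GF2 n - {0})) + G n k"
    by (simp add: sum.distrib G_eq)
  also have "int (card (GF2 n - {0})) = 2 ^ n - 1"
    using fin card_GF2[OF assms(2)] GF2_0 by (simp add: of_nat_diff)
  finally show ?thesis by simp
qed

text \<open>Both sides have constant term 1 and the same logarithmic derivative, formed by the point
  counts. The two linear factors account for the summands 1 and \<open>2 ^ n\<close>.\<close>

lemma zeta_D_eq:
  assumes "k > 0"
  shows "zeta_D k =
    fps_of_poly (map_poly of_int (L_poly k)) / ((1 - fps_X) * (1 - 2 * fps_X))"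
proof -
  define D :: "rat fps" where "D = (1 - fps_X) * (1 - 2 * fps_X)"
  define N :: "rat fps" where "N = Abs_fps (\<lambda>n. if n = 0 then 0 else of_nat (card (D_points k n)))"
  define S :: "rat fps" where
    "S = Abs_fps (\<lambda>n. if n = 0 then 0 else of_nat (card (D_points k n)) / of_nat n)"
  define L :: "rat fps" where "L = fps_of_poly (map_poly of_int (L_poly k))"
  define E :: "rat \<Rightarrow> rat fps" where "E c = - Abs_fps (\<lambda>n. if n = 0 then 0 else c ^ n)" for c
  have "fps_X * fps_deriv S = N"
    unfolding fps_mult_fps_X_deriv_shift by (auto simp: fps_eq_iff S_def N_def)
  hence "has_log_deriv (fps_exp 1 oo S) N"
    unfolding has_log_deriv_def
    by (subst fps_compose_deriv) (auto simp: S_def mult.left_commute)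
  hence ld1: "has_log_deriv (zeta_D k) N" by (simp add: zeta_D_def S_def)
  have "has_log_deriv (1 - fps_const 1 * fps_X) (E 1)" "has_log_deriv (1 - fps_const 2 * fps_X) (E 2)"
    unfolding E_def by (rule has_log_deriv_linear)+
  hence ldD: "has_log_deriv D (E 1 + E 2)"
    unfolding D_def by (intro has_log_deriv_mult) (simp_all add: numeral_fps_const)
  have D0: "D $ 0 = 1" by (simp add: D_def)
  have "has_log_deriv (L * inverse D)
      (Abs_fps (\<lambda>n. if n = 0 then 0 else of_int (G n k)) + - (E 1 + E 2))"
    unfolding L_def using D0
    by (intro has_log_deriv_mult has_log_deriv_inverse L_poly_log_deriv ldD) simp
  moreover have "Abs_fps (\<lambda>n. if n = 0 then 0 else of_int (G n k)) + - (E 1 + E 2) = N"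
  proof (rule fps_ext)
    fix n
    have "rat_of_nat (card (D_points k n)) = of_int (2 ^ n + 1 + G n k)" if "n > 0"
      using card_D_points_G[OF assms that] by (metis of_int_of_nat_eq)
    thus "(Abs_fps (\<lambda>n. if n = 0 then 0 else of_int (G n k)) + - (E 1 + E 2)) $ n = N $ n"
      by (simp add: E_def N_def)
  qed
  ultimately have ld2: "has_log_deriv (L * inverse D) N" by simp
  have "zeta_D k = L * inverse D"
    by (rule has_log_deriv_inject[OF ld1 ld2])
       (simp_all add: zeta_D_def L_def D0 coeff_map_poly coeff_L_poly L_coeff_0)
  also have "\<dots> = L / D" using D0 by (simp add: fps_divide_unit)
  finally show ?thesis by (simp add: L_def D_def)
qed

text \<open>For uniqueness, the denominator has nonzero constant term and can be multiplied
  away.\<close>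

lemma L_D_eq:
  assumes "k > 0"
  shows "L_D k = L_poly k"
  unfolding L_D_def
proof (rule the_equality)
  show "zeta_D k = fps_of_poly (map_poly of_int (L_poly k)) / ((1 - fps_X) * (1 - 2 * fps_X))"
    using assms by (rule zeta_D_eq)
next
  fix L assume L: "zeta_D k = fps_of_poly (map_poly of_int L) / ((1 - fps_X) * (1 - 2 * fps_X))"
  define D :: "rat fps" where "D = (1 - fps_X) * (1 - 2 * fps_X)"
  have "D $ 0 \<noteq> 0" by (simp add: D_def)
  hence "A / D * D = A" for A by (simp add: fps_divide_unit inverse_mult_eq_1 mult.assoc)
  hence "fps_of_poly (map_poly rat_of_int L) = fps_of_poly (map_poly of_int (L_poly k))"
    using L zeta_D_eq[OF assms] unfolding D_def[symmetric] by metis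
  hence "rat_of_int (coeff L n) = of_int (coeff (L_poly k) n)" for n
    by (simp add: fps_eq_iff coeff_map_poly)
  thus "L = L_poly k" by (simp add: poly_eq_iff)
qed

section \<open>Decompositions of the L-polynomial\<close>

text \<open>An injective passage to rational power series, where inverses and logarithmic
  derivatives are available.\<close>

definition int_series :: "int poly \<Rightarrow> rat fps" where
  "int_series q = fps_of_poly (map_poly of_int q)"

lemma int_series_nth [simp]: "int_series q $ n = of_int (coeff q n)"
  by (simp add: int_series_def coeff_map_poly)

lemma int_series_1 [simp]: "int_series 1 = 1"
  by (simp add: fps_eq_iff coeff_1)

lemma int_series_mult: "int_series (q * r) = int_series q * int_series r"
  by (simp add: fps_eq_iff fps_mult_nth coeff_mult atLeast0AtMost)

lemma int_series_prod: "int_series (\<Prod>i\<in>A. q i) = (\<Prod>i\<in>A. int_series (q i))"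
  by (induction A rule: infinite_finite_induct) (simp_all add: int_series_mult)

lemma int_series_eq_iff: "int_series q = int_series r \<longleftrightarrow> q = r"
  by (simp add: fps_eq_iff poly_eq_iff)

lemma int_series_nonzero: "q \<noteq> 0 \<Longrightarrow> int_series q \<noteq> 0"
  by (simp add: fps_eq_iff poly_eq_iff)

lemma coeff_subst_power:
  "e > 0 \<Longrightarrow> coeff (subst_power q e) n = (if e dvd n then coeff q (n div e) else 0)"
  by (simp add: subst_power_def coeff_pcompose_monom)

lemma subst_power_eq_0_iff: "e > 0 \<Longrightarrow> subst_power q e = 0 \<longleftrightarrow> q = 0"
  by (auto simp: subst_power_def pcompose_eq_0 Polynomial.degree_monom_eq)

lemma subst_power_mult: "subst_power (q * r) e = subst_power q e * subst_power r e"
  by (simp add: subst_power_def pcompose_mult)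

lemma int_series_subst_power:
  "e > 0 \<Longrightarrow> int_series (subst_power q e) = int_series q oo fps_X ^ e"
  by (simp add: fps_eq_iff coeff_subst_power fps_compose_X_power_nth)

lemma subst_power_log_deriv:
  assumes "q \<noteq> 0" "e > 0"
  obtains l where "has_log_deriv (int_series (subst_power q e)) l" "\<And>n. \<not> e dvd n \<Longrightarrow> l $ n = 0"
proof -
  obtain l where "has_log_deriv (int_series q) l"
    using has_log_deriv_ex[OF int_series_nonzero[OF assms(1)]] by blast
  from has_log_deriv_compose_monom[OF this assms(2)] show thesis
    using that assms(2)
    by (simp add: int_series_subst_power fps_compose_X_power_nth flip: fps_of_nat)
qed

section \<open>From rational to integral coefficients\<close>

lemma clear_denominators:
  fixes a :: "rat poly"
  obtains N :: int where "N > 0" "\<And>n. of_int N * coeff a n \<in> \<int>"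
proof -
  have "\<exists>N::int. N > 0 \<and> (\<forall>n. of_int N * coeff a n \<in> \<int>)"
  proof (induction a rule: pCons_induct)
    case (pCons c a)
    then obtain N where N: "N > 0" "\<forall>n. of_int N * coeff a n \<in> \<int>" by auto
    obtain r s where c: "c = of_int r / of_int s" "s > 0"
      by (metis quotient_of_div quotient_of_denom_pos surj_pair)
    have "of_int (N * s) * coeff (pCons c a) n \<in> \<int>" for n
    proof (cases n)
      case 0
      have "of_int (N * s) * coeff (pCons c a) n = of_int (N * r)" using 0 c by simp
      thus ?thesis by (metis Ints_of_int)
    next
      case (Suc j)
      have "of_int (N * s) * coeff (pCons c a) n = of_int s * (of_int N * coeff a j)"
        using Suc by simp
      thus ?thesis using N(2) by (metis Ints_mult Ints_of_int)
    qed
    thus ?case using N(1) c(2) by (intro exI[of _ "N * s"]) simp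
  qed (auto intro: exI[of _ 1])
  thus thesis using that by blast
qed

lemma Ints_poly:
  fixes f :: "rat poly"
  assumes "\<And>n. coeff f n \<in> \<int>"
  obtains g where "f = map_poly of_int g"
proof
  show "f = map_poly of_int (map_poly floor f)"
    using assms by (intro poly_eqI) (simp add: coeff_map_poly of_int_floor)
qed

lemma common_denominator:
  fixes a b :: "rat poly"
  obtains N :: rat and a' b' where "N \<noteq> 0" "map_poly of_int a' = smult N a" "map_poly of_int b' = smult N b"
proof -
  obtain M where M: "M > 0" "\<And>n. of_int M * coeff a n \<in> \<int>" using clear_denominators by blast
  obtain N where N: "N > 0" "\<And>n. of_int N * coeff b n \<in> \<int>" using clear_denominators by blast
  have "coeff (smult (of_int (M * N)) a) n \<in> \<int>" for n
    using Ints_mult[OF Ints_of_int[of N] M(2)[of n]] by (simp add: mult_ac)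
  then obtain a' where a': "smult (of_int (M * N)) a = map_poly of_int a'" by (rule Ints_poly)
  have "coeff (smult (of_int (M * N)) b) n \<in> \<int>" for n
    using Ints_mult[OF Ints_of_int[of M] N(2)[of n]] by (simp add: mult_ac)
  then obtain b' where b': "smult (of_int (M * N)) b = map_poly of_int b'" by (rule Ints_poly)
  show thesis using that[of "of_int (M * N)" a' b'] a' b' M(1) N(1) by simp
qed

text \<open>Scaling numerator and denominator by one common \<open>N\<close> preserves their
  quotient. The exponents \<open>d\<close> and \<open>e\<close> are kept apart for
  \<open>rat_funs_int_denominator\<close>, where they differ in general.\<close>

lemma int_quotient:
  assumes "f * fps_of_poly (pcompose b (Polynomial.monom 1 e)) =
      fps_of_poly (pcompose a (Polynomial.monom 1 d))" "coeff b 0 = 1" "d > 0" "e > 0"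
  obtains a' b' where "b' \<noteq> 0" "f * int_series (subst_power b' e) = int_series (subst_power a' d)"
proof -
  obtain N a' b' where N: "N \<noteq> 0" "map_poly of_int a' = smult N a" "map_poly of_int b' = smult N b"
    by (rule common_denominator)
  have "of_int (coeff b' 0) = N"
    using arg_cong[OF N(3), of "\<lambda>f. coeff f 0"] assms(2) by (simp add: coeff_map_poly)
  hence "b' \<noteq> 0" using N(1) by auto
  moreover have "int_series a' = fps_const N * fps_of_poly a"
      "int_series b' = fps_const N * fps_of_poly b"
    by (simp_all add: int_series_def N(2,3) fps_of_poly_smult)
  hence "int_series (subst_power a' d) =
      fps_const N * fps_of_poly (pcompose a (Polynomial.monom 1 d))"
    "int_series (subst_power b' e) = fps_const N * fps_of_poly (pcompose b (Polynomial.monom 1 e))"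
    using assms(3,4)
    by (simp_all add: int_series_subst_power fps_of_poly_pcompose_monom fps_compose_mult_distrib)
  ultimately show thesis
    using that[of b' a'] assms(1) by (simp add: mult.left_commute)
qed

lemma rat_funs_int:
  assumes "f \<in> rat_funs e" "e > 0"
  obtains a b where "b \<noteq> 0" "f * int_series (subst_power b e) = int_series (subst_power a e)"
  using assms(1) int_quotient[of f _ e _ e] assms(2) unfolding rat_funs_def by blast

text \<open>With a denominator in \<open>X^(d e)\<close>, the factor belonging to one prime \<open>e\<close> can pass its denominator on
  to the factor belonging to another prime \<open>d\<close>, which makes the former a polynomial.\<close>

lemma rat_funs_int_denominator:
  assumes f: "f \<in> rat_funs e" and e: "e > 0" and d: "d > 0"
  obtains a c where "c \<noteq> 0" "f * int_series (subst_power c (d * e)) = int_series (subst_power a e)"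
proof -
  obtain a b where ab: "coeff a 0 = 1" "coeff b 0 = 1"
    "f * fps_of_poly (pcompose b (Polynomial.monom 1 e)) =
       fps_of_poly (pcompose a (Polynomial.monom 1 e))"
    using f by (auto simp: rat_funs_def)
  have "fps_of_poly b \<noteq> 0"
    using ab(2) by (metis coeff_0 fps_of_poly_0 fps_of_poly_nth zero_neq_one fps_zero_nth)
  then obtain lb where lb: "has_log_deriv (fps_of_poly b) lb"
    using has_log_deriv_ex by blast
  \<comment> \<open>Multiplying \<open>b\<close> by its cofactor gives a polynomial in
    \<open>X^d\<close>; substituting \<open>X^e\<close> then gives the denominator in
    \<open>X^(d e)\<close>.\<close>
  obtain b' c where bc: "coeff b' 0 = 1" "coeff c 0 = 1" "b * b' = pcompose c (Polynomial.monom 1 d)"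
    using norm_to_monom[OF ab(2) d lb] by blast
  have "pcompose c (Polynomial.monom 1 (d * e)) =
      pcompose (pcompose c (Polynomial.monom 1 d)) (Polynomial.monom 1 e)"
    using d e by (simp add: pcompose_monom_monom)
  hence "f * fps_of_poly (pcompose c (Polynomial.monom 1 (d * e))) =
      f * fps_of_poly (pcompose b (Polynomial.monom 1 e)) * fps_of_poly (pcompose b' (Polynomial.monom 1 e))"
    by (simp add: pcompose_mult fps_of_poly_mult mult.assoc flip: bc(3))
  also have "\<dots> = fps_of_poly (pcompose (a * b') (Polynomial.monom 1 e))"
    unfolding ab(3) by (simp add: pcompose_mult fps_of_poly_mult)
  finally show thesis
    by (rule int_quotient) (use bc(2) d e that in auto)
qed

text \<open>A nonconstant \<open>B\<close> would have degree 2 or 3 and no linear term, which forces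
  equal constant and linear coefficients of \<open>w\<close>. Comparing the remaining coefficients
  refutes both degrees.\<close>

lemma L_1_no_subst_power_factor:
  fixes b w :: "rat poly"
  assumes "[:1, 1, 0, 2, 4:] = pcompose b (Polynomial.monom 1 e) * w" "e \<ge> 2"
  shows "Polynomial.degree b = 0"
proof (rule ccontr)
  assume nz: "Polynomial.degree b \<noteq> 0"
  define B where "B = pcompose b (Polynomial.monom 1 e)"
  have L: "[:1, 1, 0, 2, 4:] = B * w" using assms(1) by (simp add: B_def)
  have nz': "B \<noteq> 0" "w \<noteq> 0" using L by auto
  have "Polynomial.degree (B * w) = 4" by (simp flip: L)
  hence deg: "Polynomial.degree B + Polynomial.degree w = 4" using nz' by (simp add: degree_mult_eq)
  have degB: "Polynomial.degree B = Polynomial.degree b * e"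
    by (simp add: B_def degree_pcompose Polynomial.degree_monom_eq)
  have B: "coeff B i = 0" if "\<not> e dvd i" for i using that assms(2) by (simp add: B_def coeff_pcompose_monom)
  have Bdeg: "coeff B i = 0" if "i > Polynomial.degree B" for i using that by (rule coeff_eq_0)
  have wdeg: "coeff w i = 0" if "i > Polynomial.degree w" for i using that by (rule coeff_eq_0)
  have B1: "coeff B 1 = 0" using assms(2) by (intro B) auto
  have c: "coeff B 0 * coeff w 0 = 1" "coeff B 0 * coeff w 1 = 1"
     "coeff B 0 * coeff w 2 + coeff B 2 * coeff w 0 = 0"
     "coeff B 0 * coeff w 3 + coeff B 2 * coeff w 1 + coeff B 3 * coeff w 0 = 2"
     "coeff B 0 * coeff w 4 + coeff B 2 * coeff w 2 + coeff B 3 * coeff w 1 + coeff B 4 * coeff w 0 = 4"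
    using arg_cong[OF L, of "\<lambda>f. coeff f 0"] arg_cong[OF L, of "\<lambda>f. coeff f 1"]
      arg_cong[OF L, of "\<lambda>f. coeff f 2"] arg_cong[OF L, of "\<lambda>f. coeff f 3"]
      arg_cong[OF L, of "\<lambda>f. coeff f 4"] B1
    by (simp_all add: coeff_mult numeral_eq_Suc)
  have w01: "coeff w 0 = coeff w 1" using c(1,2) by (metis mult_cancel_left zero_neq_one mult_zero_left)
  have "Polynomial.degree w \<noteq> 0"
  proof
    assume "Polynomial.degree w = 0"
    hence "coeff w 1 = 0" by (intro wdeg) simp
    thus False using c(2) by simp
  qed
  hence "Polynomial.degree B \<le> 3" using deg by linarith
  moreover have "e \<le> Polynomial.degree B" using degB nz by simp
  moreover have "e = 3" if "Polynomial.degree B = 3"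
  proof -
    have "e dvd 3" using degB that by (metis dvd_triv_right)
    hence "e \<le> 3" "e \<noteq> 2" by (auto dest: dvd_imp_le)
    thus ?thesis using assms(2) by linarith
  qed
  ultimately consider "Polynomial.degree B = 2" | "Polynomial.degree B = 3" "e = 3"
    using assms(2) by linarith
  thus False
  proof cases
    case 1
    hence "coeff w 3 = 0" "coeff w 4 = 0" "coeff B 3 = 0" "coeff B 4 = 0"
      using deg by (auto intro!: Bdeg wdeg)
    hence *: "coeff B 2 * coeff w 1 = 2" "coeff B 2 * coeff w 2 = 4" using c by simp_all
    hence "coeff B 2 * (coeff w 2 - 2 * coeff w 1) = 0" by (simp add: algebra_simps)
    moreover have "coeff B 2 \<noteq> 0" using * by auto
    ultimately have "coeff w 2 = 2 * coeff w 1" by simp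
    thus False using c(2,3) * w01 by simp
  next
    case 2
    hence "coeff w 2 = 0" "coeff w 3 = 0" "coeff w 4 = 0" "coeff B 2 = 0" "coeff B 4 = 0"
      using deg by (auto intro!: Bdeg wdeg B)
    thus False using c w01 by simp
  qed
qed

text \<open>The case of a single prime. In lowest terms the denominator, evaluated at
  \<open>X^e\<close>, divides the polynomial for \<open>k = 1\<close>, and so it is
  constant.\<close>

lemma rat_funs_L_poly_quotient:
  assumes f: "f \<in> rat_funs e" "e \<ge> 2" "f * int_series (L_poly 1) = int_series (L_poly k)"
  obtains q where "int_series (L_poly k) = int_series (subst_power q e) * int_series (L_poly 1)"
proof -
  define Xe where "Xe = Polynomial.monom (1 :: rat) e"
  define Lk :: "rat poly" where "Lk = map_poly of_int (L_poly k)"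
  define L1 :: "rat poly" where "L1 = map_poly of_int (L_poly 1)"
  obtain a b where ab: "coeff a 0 = 1" "coeff b 0 = 1"
    "f * fps_of_poly (pcompose b Xe) = fps_of_poly (pcompose a Xe)"
    using f(1) by (auto simp: rat_funs_def Xe_def)
  have "fps_of_poly (Lk * pcompose b Xe) = fps_of_poly (L1 * pcompose a Xe)"
    using f(3) by (simp add: fps_of_poly_mult Lk_def L1_def int_series_def mult_ac flip: ab(3))
  hence L: "Lk * pcompose b Xe = L1 * pcompose a Xe" by (simp only: fps_of_poly_eq_iff)
  have "b \<noteq> 0" using ab(2) by auto
  then obtain a1 b1 where ab1: "a = a1 * gcd a b" "b = b1 * gcd a b" "coprime a1 b1"
    by (metis gcd_coprime_exists gcd_eq_0_iff)
  have "b1 \<noteq> 0" using \<open>b \<noteq> 0\<close> ab1(2) by auto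
  have "pcompose (gcd a b) Xe \<noteq> 0"
    using \<open>b \<noteq> 0\<close> f(2) pcompose_eq_0[of "gcd a b" Xe]
    by (auto simp: Xe_def Polynomial.degree_monom_eq)
  moreover have "Lk * pcompose b1 Xe * pcompose (gcd a b) Xe = L1 * pcompose a1 Xe * pcompose (gcd a b) Xe"
    using L by (metis ab1(1,2) pcompose_mult mult.assoc)
  ultimately have L': "Lk * pcompose b1 Xe = L1 * pcompose a1 Xe" by simp
  \<comment> \<open>A Bezout relation survives the substitution of \<open>X^e\<close>, so the
    substituted polynomials remain coprime.\<close>
  obtain u v where uv: "u * a1 + v * b1 = 1"
    using bezout_coefficients_fst_snd[of a1 b1] ab1(3) by (metis coprime_imp_gcd_eq_1)
  have "pcompose u Xe * pcompose a1 Xe + pcompose v Xe * pcompose b1 Xe = 1"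
    using arg_cong[OF uv, of "\<lambda>h. pcompose h Xe"] by (simp add: pcompose_add pcompose_mult pcompose_1)
  hence "L1 = L1 * (pcompose u Xe * pcompose a1 Xe + pcompose v Xe * pcompose b1 Xe)" by simp
  also have "\<dots> = pcompose u Xe * (L1 * pcompose a1 Xe) + L1 * (pcompose v Xe * pcompose b1 Xe)"
    by (simp add: algebra_simps)
  also have "\<dots> = pcompose b1 Xe * (pcompose u Xe * Lk + L1 * pcompose v Xe)"
    by (simp add: algebra_simps flip: L')
  finally have "L1 = pcompose b1 Xe * (pcompose u Xe * Lk + L1 * pcompose v Xe)" .
  moreover have "L1 = [:1, 1, 0, 2, 4:]" 
    unfolding L1_def L_poly_1 by (simp add: map_poly_pCons)
  ultimately have "Polynomial.degree b1 = 0"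
    using L_1_no_subst_power_factor f(2) unfolding Xe_def by metis
  then obtain \<beta> where \<beta>: "b1 = [:\<beta>:]" by (metis degree_eq_zeroE)
  hence "\<beta> \<noteq> 0" using \<open>b1 \<noteq> 0\<close> by simp
  define q where "q = smult (inverse \<beta>) a1"
  have "smult \<beta> Lk = L1 * pcompose a1 Xe" using L' by (simp add: \<beta> pcompose_const)
  hence "smult (inverse \<beta>) (smult \<beta> Lk) = L1 * pcompose q Xe"
    by (simp add: q_def pcompose_smult)
  hence Lq: "Lk = L1 * pcompose q Xe" using \<open>\<beta> \<noteq> 0\<close> by simp
  \<comment> \<open>Integrality comes from dividing an integral series by one with constant term
    1.\<close>
  have "fps_of_poly (pcompose q Xe) $ n \<in> \<int>" for n
  proof (rule fps_quotient_nth_mem[of "\<int>" "fps_of_poly L1"])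
    show "fps_of_poly L1 $ 0 = 1" by (simp add: L1_def coeff_map_poly coeff_L_poly L_coeff_0)
    show "fps_of_poly L1 $ n \<in> \<int>" for n by (simp add: L1_def coeff_map_poly)
    show "(fps_of_poly L1 * fps_of_poly (pcompose q Xe)) $ n \<in> \<int>" for n
      unfolding fps_of_poly_mult[symmetric] Lq[symmetric] by (simp add: Lk_def coeff_map_poly)
  qed auto
  from this[of "e * _"] have "coeff q n \<in> \<int>" for n
    using f(2) by (simp add: Xe_def coeff_pcompose_monom)
  then obtain q' where q': "q = map_poly of_int q'" by (rule Ints_poly)
  have "int_series (subst_power q' e) = fps_of_poly (pcompose q Xe)"
    using f(2) by (simp add: int_series_subst_power Xe_def fps_of_poly_pcompose_monom q'
        flip: int_series_def)
  thus thesis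
    using that[of q'] Lq
    by (simp add: int_series_def L1_def Lk_def fps_of_poly_mult[symmetric] mult.commute)
qed

section \<open>Identities of fractions as identities of power series\<close>

lemma to_fract_prod: "to_fract (\<Prod>i\<in>A. f i) = (\<Prod>i\<in>A. to_fract (f i))"
  by (induction A rule: infinite_finite_induct) simp_all

lemma to_fract_quotient_eq_iff:
  fixes L Q L1 :: "int poly"
  assumes "\<And>i. i \<in> A \<Longrightarrow> D i \<noteq> 0"
  shows "to_fract L = (\<Prod>i\<in>A. to_fract (N i) / to_fract (D i)) * to_fract Q * to_fract L1 \<longleftrightarrow>
    int_series L * (\<Prod>i\<in>A. int_series (D i)) =
      (\<Prod>i\<in>A. int_series (N i)) * int_series Q * int_series L1"
proof -
  have nz: "to_fract (\<Prod>i\<in>A. D i) \<noteq> 0"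
    using assms by (induction A rule: infinite_finite_induct) auto
  have "to_fract L = (\<Prod>i\<in>A. to_fract (N i) / to_fract (D i)) * to_fract Q * to_fract L1 \<longleftrightarrow>
    to_fract L = to_fract ((\<Prod>i\<in>A. N i) * Q * L1) / to_fract (\<Prod>i\<in>A. D i)"
    by (simp add: prod_dividef to_fract_prod)
  also have "\<dots> \<longleftrightarrow> to_fract (L * (\<Prod>i\<in>A. D i)) = to_fract ((\<Prod>i\<in>A. N i) * Q * L1)"
    using nz by (simp add: field_simps)
  also have "\<dots> \<longleftrightarrow> int_series (L * (\<Prod>i\<in>A. D i)) = int_series ((\<Prod>i\<in>A. N i) * Q * L1)"
    by (simp only: to_fract_eq_iff int_series_eq_iff)
  finally show ?thesis by (simp add: int_series_mult int_series_prod)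
qed

lemma prod_coprime_iff_not_dvd:
  fixes p a :: "'i \<Rightarrow> nat"
  assumes "finite A" "\<And>i. i \<in> A \<Longrightarrow> prime (p i)" "\<And>i. i \<in> A \<Longrightarrow> a i \<ge> 1"
  shows "coprime (\<Prod>i\<in>A. p i ^ a i) n \<longleftrightarrow> (\<forall>i\<in>A. \<not> p i dvd n)"
proof
  assume cop: "coprime (\<Prod>i\<in>A. p i ^ a i) n"
  show "\<forall>i\<in>A. \<not> p i dvd n"
  proof
    fix i assume i: "i \<in> A"
    have "p i dvd p i ^ a i" using assms(3)[OF i] by (intro dvd_power) auto
    also have "\<dots> dvd (\<Prod>i\<in>A. p i ^ a i)" using assms(1) i by (rule dvd_prodI)
    finally show "\<not> p i dvd n"
      using cop assms(2)[OF i] coprime_common_divisor not_prime_unit by metis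
  qed
next
  assume "\<forall>i\<in>A. \<not> p i dvd n"
  thus "coprime (\<Prod>i\<in>A. p i ^ a i) n"
    using assms(2) by (intro prod_coprime_left) (auto intro: prime_imp_coprime)
qed

theorem theorem27:
  fixes k m :: nat and p a :: "nat \<Rightarrow> nat"
  assumes "m \<ge> 1"
    and "\<And>i. i \<in> {1..m} \<Longrightarrow> prime (p i)"
    and "inj_on p {1..m}"
    and "\<And>i. i \<in> {1..m} \<Longrightarrow> a i \<ge> 1"
    and "k = (\<Prod>i = 1..m. p i ^ a i)"
  shows "(\<forall>n > 0. coprime k n \<longrightarrow> G n k = G n 1) \<longleftrightarrow>
    (\<exists>(q1 :: int poly) (qn :: nat \<Rightarrow> int poly) (qd :: nat \<Rightarrow> int poly).
       (\<forall>i \<in> {2..m}. qd i \<noteq> 0) \<and>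
       to_fract (L_D k) =
         (\<Prod>i = 2..m. to_fract (subst_power (qn i) (p i)) / to_fract (subst_power (qd i) (p i)))
         * to_fract (subst_power q1 (p 1)) * to_fract (L_D 1))"
proof -
  have pos: "p i > 0" if "i \<in> {1..m}" for i using assms(2)[OF that] by (rule prime_gt_0_nat)
  have cop: "coprime k n \<longleftrightarrow> (\<forall>i\<in>{1..m}. \<not> p i dvd n)" for n
    using prod_coprime_iff_not_dvd[of "{1..m}" p a n] assms(2,4) by (simp add: assms(5))
  have "k > 0" unfolding assms(5) using pos by (intro prod_pos) auto
  hence LD: "L_D k = L_poly k" "L_D 1 = L_poly 1" by (simp_all add: L_D_eq)
  have L0: "int_series (L_poly j) $ 0 = 1" for j by (simp add: coeff_L_poly L_coeff_0)
  define S where "S = (\<lambda>j. Abs_fps (\<lambda>n. if n = 0 then 0 else rat_of_int (G n j)))"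
  have ldL: "has_log_deriv (int_series (L_poly j)) (S j)" for j
    unfolding int_series_def S_def by (rule L_poly_log_deriv)
  have iff: "to_fract (L_D k) =
        (\<Prod>i = 2..m. to_fract (subst_power (qn i) (p i)) / to_fract (subst_power (qd i) (p i)))
         * to_fract (subst_power q1 (p 1)) * to_fract (L_D 1) \<longleftrightarrow>
      int_series (L_poly k) * (\<Prod>i=2..m. int_series (subst_power (qd i) (p i))) =
        (\<Prod>i=2..m. int_series (subst_power (qn i) (p i))) * int_series (subst_power q1 (p 1))
          * int_series (L_poly 1)"
    if "\<forall>i\<in>{2..m}. qd i \<noteq> 0" for q1 qn qd
    unfolding LD using that pos by (intro to_fract_quotient_eq_iff) (auto simp: subst_power_eq_0_iff)
  show ?thesis
  proof
    assume "\<exists>q1 qn qd. (\<forall>i\<in>{2..m}. qd i \<noteq> 0) \<and>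
      to_fract (L_D k) =
         (\<Prod>i = 2..m. to_fract (subst_power (qn i) (p i)) / to_fract (subst_power (qd i) (p i)))
         * to_fract (subst_power q1 (p 1)) * to_fract (L_D 1)"
    then obtain q1 qn qd where qd: "\<forall>i\<in>{2..m}. qd i \<noteq> 0" and eq:
      "int_series (L_poly k) * (\<Prod>i=2..m. int_series (subst_power (qd i) (p i))) =
        (\<Prod>i=2..m. int_series (subst_power (qn i) (p i))) * int_series (subst_power q1 (p 1))
          * int_series (L_poly 1)"
      using iff by blast
    \<comment> \<open>Nonvanishing forces all numerators to be nonzero, so that they have
      logarithmic derivatives, and it makes the logarithmic derivative of the product
      unique.\<close>
    have nz: "int_series (L_poly k) * (\<Prod>i=2..m. int_series (subst_power (qd i) (p i))) \<noteq> 0"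
    proof -
      have "int_series (subst_power (qd i) (p i)) \<noteq> 0" if "i \<in> {2..m}" for i
        using that qd pos[of i] by (intro int_series_nonzero) (simp add: subst_power_eq_0_iff)
      moreover have "L_poly k \<noteq> 0" using coeff_L_poly[of k 0] L_coeff_0[of k] by auto
      hence "int_series (L_poly k) \<noteq> 0" by (rule int_series_nonzero)
      ultimately show ?thesis by simp
    qed
    have sqn: "subst_power (qn i) (p i) \<noteq> 0" if "i \<in> {2..m}" for i
    proof
      assume "subst_power (qn i) (p i) = 0"
      hence "(\<Prod>i=2..m. int_series (subst_power (qn i) (p i))) = 0"
        using that by (intro prod_zero bexI[of _ i]) (auto simp: fps_eq_iff)
      thus False using nz unfolding eq by simp
    qed
    have qn: "qn i \<noteq> 0" if "i \<in> {2..m}" for i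
      using sqn[OF that] that pos[of i] by (auto simp: subst_power_eq_0_iff)
    have "subst_power q1 (p 1) \<noteq> 0"
    proof
      assume "subst_power q1 (p 1) = 0"
      hence "int_series (subst_power q1 (p 1)) = 0" by (simp add: fps_eq_iff)
      thus False using nz unfolding eq by simp
    qed
    hence q1: "q1 \<noteq> 0" using pos[of 1] assms(1) by (auto simp: subst_power_eq_0_iff)
    have log_derivs: "\<exists>l. \<forall>i\<in>{2..m}. has_log_deriv (int_series (subst_power (q i) (p i))) (l i) \<and>
        (\<forall>n. \<not> p i dvd n \<longrightarrow> l i $ n = 0)" if "\<And>i. i \<in> {2..m} \<Longrightarrow> q i \<noteq> 0" for q
    proof (intro bchoice ballI)
      fix i assume i: "i \<in> {2..m}"
      hence "p i > 0" by (intro pos) simp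
      thus "\<exists>l. has_log_deriv (int_series (subst_power (q i) (p i))) l \<and>
        (\<forall>n. \<not> p i dvd n \<longrightarrow> l $ n = 0)"
        using subst_power_log_deriv[OF that[OF i], of "p i"] by metis
    qed
    obtain ld where ld: "\<And>i. i \<in> {2..m} \<Longrightarrow> has_log_deriv (int_series (subst_power (qd i) (p i))) (ld i)"
      "\<And>i n. i \<in> {2..m} \<Longrightarrow> \<not> p i dvd n \<Longrightarrow> ld i $ n = 0"
      using log_derivs[of qd] qd by blast
    obtain ln where ln: "\<And>i. i \<in> {2..m} \<Longrightarrow> has_log_deriv (int_series (subst_power (qn i) (p i))) (ln i)"
      "\<And>i n. i \<in> {2..m} \<Longrightarrow> \<not> p i dvd n \<Longrightarrow> ln i $ n = 0"
      using log_derivs[of qn] qn by blast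
    obtain l1 where l1: "has_log_deriv (int_series (subst_power q1 (p 1))) l1"
      "\<And>n. \<not> p 1 dvd n \<Longrightarrow> l1 $ n = 0"
      using subst_power_log_deriv[OF q1, of "p 1"] pos[of 1] assms(1) by auto
    have "has_log_deriv (int_series (L_poly k) * (\<Prod>i=2..m. int_series (subst_power (qd i) (p i))))
        (S k + (\<Sum>i=2..m. ld i))"
      by (intro has_log_deriv_mult has_log_deriv_prod ldL ld(1))
    moreover have "has_log_deriv ((\<Prod>i=2..m. int_series (subst_power (qn i) (p i))) *
        int_series (subst_power q1 (p 1)) * int_series (L_poly 1)) ((\<Sum>i=2..m. ln i) + l1 + S 1)"
      by (intro has_log_deriv_mult has_log_deriv_prod ldL ln(1) l1(1))
    ultimately have l: "S k + (\<Sum>i=2..m. ld i) = (\<Sum>i=2..m. ln i) + l1 + S 1"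
      using nz unfolding eq by (rule has_log_deriv_unique)
    show "\<forall>n>0. coprime k n \<longrightarrow> G n k = G n 1"
    proof (intro allI impI)
      fix n :: nat assume n: "n > 0" "coprime k n"
      hence "\<And>i. i \<in> {1..m} \<Longrightarrow> \<not> p i dvd n" by (simp add: cop)
      hence "(\<Sum>i=2..m. ld i $ n) = 0" "(\<Sum>i=2..m. ln i $ n) = 0" "l1 $ n = 0"
        using ld(2) ln(2) l1(2) assms(1) by (auto intro!: sum.neutral)
      thus "G n k = G n 1"
        using arg_cong[OF l, of "\<lambda>f. f $ n"] n(1) by (simp add: S_def fps_sum_nth)
    qed
  next
    assume G: "\<forall>n>0. coprime k n \<longrightarrow> G n k = G n 1"
    define f where "f = int_series (L_poly k) * inverse (int_series (L_poly 1))"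
    have fL: "f * int_series (L_poly 1) = int_series (L_poly k)"
      using inverse_mult_eq_1[of "int_series (L_poly 1)"] L0[of 1] by (simp add: f_def mult.assoc)
    have ldf: "has_log_deriv f (S k + - S 1)"
      unfolding f_def using L0[of 1] by (intro has_log_deriv_mult has_log_deriv_inverse ldL) simp
    have f: "f \<in> rat_funs 1"
      by (rule rat_funs_1I[of f "map_poly of_int (L_poly 1)" "map_poly of_int (L_poly k)"])
         (use fL in \<open>simp_all add: int_series_def coeff_map_poly coeff_L_poly L_coeff_0\<close>)
    have "f \<in> rat_fun_prods (p ` {1..m})"
    proof (rule rat_fun_prods_if_log_deriv[OF _ _ _ f ldf])
      fix n assume "\<And>q. q \<in> p ` {1..m} \<Longrightarrow> \<not> q dvd n"
      hence "coprime k n" by (simp add: cop)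
      thus "(S k + - S 1) $ n = 0" using G by (simp add: S_def)
    qed (use assms in auto)
    then obtain F where F: "\<forall>e\<in>p ` {1..m}. F e \<in> rat_funs e" "f = (\<Prod>e\<in>p ` {1..m}. F e)"
      by (auto simp: rat_fun_prods_def)
    have Fp: "F (p i) \<in> rat_funs (p i)" if "i \<in> {1..m}" for i using F(1) that by blast
    \<comment> \<open>The factor for \<open>p 1\<close> is split off, since it alone has to become a
      polynomial.\<close>
    have "{1..m} = insert 1 {2..m}" using assms(1) by auto
    hence fF: "f = F (p 1) * (\<Prod>i=2..m. F (p i))"
      unfolding F(2) using assms(3) by (simp add: prod.reindex)
    have "\<exists>b c. b \<noteq> 0 \<and> F (p i) * int_series (subst_power b (p i)) = int_series (subst_power c (p i))"
      if "i \<in> {2..m}" for i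
    proof -
      have "i \<in> {1..m}" using that by simp
      from rat_funs_int[OF Fp[OF this] pos[OF this]] show ?thesis by metis
    qed
    then obtain b a' where b: "\<And>i. i \<in> {2..m} \<Longrightarrow> b i \<noteq> 0"
      "\<And>i. i \<in> {2..m} \<Longrightarrow> F (p i) * int_series (subst_power (b i) (p i)) =
        int_series (subst_power (a' i) (p i))" by metis
    have prods: "(\<Prod>i=2..m. F (p i)) * (\<Prod>i=2..m. int_series (subst_power (b i) (p i))) =
        (\<Prod>i=2..m. int_series (subst_power (a' i) (p i)))"
      unfolding prod.distrib[symmetric] by (rule prod.cong) (simp_all add: b(2))
    have "\<exists>q1 qn qd. (\<forall>i\<in>{2..m}. qd i \<noteq> 0) \<and>
      int_series (L_poly k) * (\<Prod>i=2..m. int_series (subst_power (qd i) (p i))) =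
        (\<Prod>i=2..m. int_series (subst_power (qn i) (p i))) * int_series (subst_power q1 (p 1))
          * int_series (L_poly 1)"
    proof (cases "m = 1")
      case True
      have "f \<in> rat_funs (p 1)" using Fp[of 1] fF True by simp
      moreover have "p 1 \<ge> 2" using assms(2)[of 1] assms(1) by (intro prime_ge_2_nat) simp
      ultimately obtain q where "int_series (L_poly k) =
          int_series (subst_power q (p 1)) * int_series (L_poly 1)"
        using fL by (rule rat_funs_L_poly_quotient)
      thus ?thesis using True by (intro exI[of _ q]) simp
    next
      case False
      hence m: "2 \<in> {2..m}" using assms(1) by simp
      have p12: "p 1 > 0" "p 2 > 0" using pos[of 1] pos[of 2] m by simp_all
      have "1 \<in> {1..m}" using assms(1) by simp
      then obtain u c where c: "c \<noteq> 0"
        "F (p 1) * int_series (subst_power c (p 2 * p 1)) = int_series (subst_power u (p 1))"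
        using rat_funs_int_denominator[OF Fp p12] by metis
      \<comment> \<open>The denominator of the factor for \<open>p 1\<close> is also a polynomial in
        \<open>X^(p 2)\<close>, so the denominator for \<open>p 2\<close> can absorb it.\<close>
      define qd where "qd = (\<lambda>i. if i = 2 then b 2 * subst_power c (p 1) else b i)"
      have sc: "subst_power (subst_power c (p 1)) (p 2) = subst_power c (p 2 * p 1)"
        using p12 by (simp add: subst_power_def pcompose_monom_monom mult.commute)
      have "(\<Prod>i=2..m. int_series (subst_power (qd i) (p i))) =
          (\<Prod>i=2..m. int_series (subst_power (b i) (p i)) *
            (if i = 2 then int_series (subst_power c (p 2 * p 1)) else 1))"
        by (rule prod.cong) (simp_all add: qd_def subst_power_mult int_series_mult sc del: One_nat_def)
      also have "\<dots> = (\<Prod>i=2..m. int_series (subst_power (b i) (p i))) *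
          int_series (subst_power c (p 2 * p 1))"
        using m by (simp add: prod.distrib prod.delta)
      finally have "int_series (L_poly k) * (\<Prod>i=2..m. int_series (subst_power (qd i) (p i))) =
          ((\<Prod>i=2..m. F (p i)) * (\<Prod>i=2..m. int_series (subst_power (b i) (p i)))) *
          (F (p 1) * int_series (subst_power c (p 2 * p 1))) * int_series (L_poly 1)"
        unfolding fL[symmetric] fF by (simp only: mult_ac)
      hence "int_series (L_poly k) * (\<Prod>i=2..m. int_series (subst_power (qd i) (p i))) =
          (\<Prod>i=2..m. int_series (subst_power (a' i) (p i))) * int_series (subst_power u (p 1)) *
          int_series (L_poly 1)" unfolding prods c(2) .
      moreover have "\<forall>i\<in>{2..m}. qd i \<noteq> 0"
        using b(1) m c(1) p12 by (auto simp: qd_def subst_power_eq_0_iff)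
      ultimately show ?thesis by blast
    qed
    thus "\<exists>q1 qn qd. (\<forall>i\<in>{2..m}. qd i \<noteq> 0) \<and>
      to_fract (L_D k) =
         (\<Prod>i = 2..m. to_fract (subst_power (qn i) (p i)) / to_fract (subst_power (qd i) (p i)))
         * to_fract (subst_power q1 (p 1)) * to_fract (L_D 1)"
      using iff by blast
  qed
qed

end
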